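(* Assume that $P_X$ is non-degenerate and that $n\ge d$. Then the minimax excess risks over the classes $\mathcal P_{\mathrm{well}}(P_X,\sigma^2)$ and $\mathcal P_{\mathrm{Gauss}}(P_X,\sigma^2)$ are both equal to $$\inf_{\widehat\beta_n}\ \sup_{P\in\mathcal P_{\mathrm{Gauss}}(P_X,\sigma^2)}\mathbb E\big[\mathcal E_P(\widehat\beta_n)\big]\;=\;\sigma^2\cdot\mathbb E\bigg[\frac{\widehat\ell_{n+1}}{1-\widehat\ell_{n+1}}\bigg],$$ where the expectation on the right is over an i.i.d. sample $X_1,\dots,X_{n+1}$ drawn from $P_X$, and $$\widehat\ell_{n+1}=\bigg\langle\bigg(\sum_{i=1}^{n+1}X_iX_i^\top\bigg)^{-1}X_{n+1},X_{n+1}\bigg\rangle$$ is the statistical leverage score of $X_{n+1}$ among $X_1,\dots,X_{n+1}$.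
   Context: Let $n,d\ge 1$ be integers, $\sigma^2>0$, and let $P_X$ be a probability distribution on $\mathbb R^d$ such that, for $X\sim P_X$, $\mathbb E\|X\|^2<\infty$ and $\Sigma:=\mathbb E[XX^\top]$ is invertible. $P_X$ is called degenerate if there is $\theta\in\mathbb R^d$, $\|\theta\|=1$, with $\mathbb P(\langle\theta,X\rangle=0)>0$; otherwise it is non-degenerate. When $P_X$ is non-degenerate and $n\ge d$, $\sum_{i=1}^{n}X_iX_i^\top$ and $\sum_{i=1}^{n+1}X_iX_i^\top$ are almost surely invertible. Joint distributions $P$ of $(X,Y)\in\mathbb R^d\times\mathbb R$ are written through $Y=\langle\beta^*,X\rangle+\varepsilon$. The class $\mathcal P_{\mathrm{Gauss}}(P_X,\sigma^2)$ consists of all $P$ with $X\sim P_X$, $\beta^*\in\mathbb R^d$ arbitrary and $\varepsilon\,|\,X\sim\mathcal N(0,\sigma^2)$. The class $\mathcal P_{\mathrm{well}}(P_X,\sigma^2)$ consists of all $P$ with $X\sim P_X$, $\beta^*\in\mathbb R^d$ arbitrary, $\mathbb E[\varepsilon|X]=0$ and $\mathbb E[\varepsilon^2|X]\le\sigma^2$. The risk of $\beta\in\mathbb R^d$ under $P$ is $R(\beta)=\mathbb E[(Y-\langle\beta,X\rangle)^2]$; it is uniquely minimized at $\beta^*$, and the excess risk is $\mathcal E_P(\beta)=R(\beta)-R(\beta^* )=\|\Sigma^{1/2}(\beta-\beta^* )\|^2$. An estimator $\widehat\beta_n$ is an $\mathbb R^d$-valued measurable function of an i.i.d. sample $(X_1,Y_1),\dots,(X_n,Y_n)$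 from $P$. The minimax excess risk over a class $\mathcal P$ is $\inf_{\widehat\beta_n}\sup_{P\in\mathcal P}\mathbb E[\mathcal E_P(\widehat\beta_n)]$, the infimum being over all estimators and the expectation over the sample. *)

theory Defs
  imports "HOL-Probability.Probability"
begin

definition outer :: "real ^ 'd \<Rightarrow> real ^ 'd ^ 'd" where
  "outer x = (\<chi> i j. x $ i * x $ j)"

definition second_moment :: "(real ^ 'd) measure \<Rightarrow> real ^ 'd ^ 'd" where
  "second_moment PX = (\<integral>x. outer x \<partial>PX)"

definition degenerate :: "(real ^ 'd) measure \<Rightarrow> bool" where
  "degenerate PX \<longleftrightarrow>
     (\<exists>\<theta>. norm \<theta> = 1 \<and> measure PX {x \<in> space PX. \<theta> \<bullet> x = 0} > 0)"

text \<open>A law \<open>P\<close> of \<open>(X, Y)\<close> is a measure on pairs, with \<open>X = fst\<close> and \<open>Y = snd\<close>.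
  \<open>sigma_X P\<close> is the sigma-algebra generated by \<open>X\<close>, as needed for conditioning on \<open>X\<close>.\<close>

definition sigma_X :: "((real ^ 'd) \<times> real) measure \<Rightarrow> ((real ^ 'd) \<times> real) measure" where
  "sigma_X P = vimage_algebra (space P) fst borel"

definition noise :: "real ^ 'd \<Rightarrow> (real ^ 'd) \<times> real \<Rightarrow> real" where
  "noise \<beta> z = snd z - \<beta> \<bullet> fst z"

definition joint_law :: "(real ^ 'd) measure \<Rightarrow> ((real ^ 'd) \<times> real) measure \<Rightarrow> bool" where
  "joint_law PX P \<longleftrightarrow> prob_space P \<and> sets P = sets borel \<and> distr P borel fst = PX"

text \<open>The conditional law of the noise given \<open>X\<close> is the centred normal law of variance
  \<open>\<sigma>\<^sup>2\<close>: every event of the noise has the corresponding constant conditional probability.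
  The second parameter of \<open>normal_density\<close> is the standard deviation.\<close>

definition P_Gauss :: "(real ^ 'd) measure \<Rightarrow> real \<Rightarrow> ((real ^ 'd) \<times> real) measure set" where
  "P_Gauss PX \<sigma> = {P. joint_law PX P \<and>
     (\<exists>\<beta>. \<forall>B \<in> sets borel. AE z in P.
        real_cond_exp P (sigma_X P) (\<lambda>z. indicator B (noise \<beta> z)) z
          = measure (density lborel (normal_density 0 \<sigma>)) B)}"

text \<open>Integrability of the squared noise is implicit in the bound on its conditional
  expectation; it has to be explicit because \<open>real_cond_exp\<close> is total.\<close>

definition P_well :: "(real ^ 'd) measure \<Rightarrow> real \<Rightarrow> ((real ^ 'd) \<times> real) measure set" where
  "P_well PX \<sigma> = {P. joint_law PX P \<and>
     (\<exists>\<beta>. integrable P (\<lambda>z. (noise \<beta> z)\<^sup>2) \<and>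
        (AE z in P. real_cond_exp P (sigma_X P) (noise \<beta>) z = 0) \<and>
        (AE z in P. real_cond_exp P (sigma_X P) (\<lambda>z. (noise \<beta> z)\<^sup>2) z \<le> \<sigma>\<^sup>2))}"

definition risk :: "((real ^ 'd) \<times> real) measure \<Rightarrow> real ^ 'd \<Rightarrow> real" where
  "risk P \<beta> = (\<integral>z. (snd z - \<beta> \<bullet> fst z)\<^sup>2 \<partial>P)"

definition beta_star :: "((real ^ 'd) \<times> real) measure \<Rightarrow> real ^ 'd" where
  "beta_star P = (ARG_MIN (risk P) \<beta>. True)"

definition excess_risk :: "((real ^ 'd) \<times> real) measure \<Rightarrow> real ^ 'd \<Rightarrow> real" where
  "excess_risk P \<beta> = risk P \<beta> - risk P (beta_star P)"

definition estimators :: "nat \<Rightarrow> ((nat \<Rightarrow> (real ^ 'd) \<times> real) \<Rightarrow> real ^ 'd) set" where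
  "estimators n = measurable (PiM {1..n} (\<lambda>_. borel)) borel"

text \<open>The excess risk is nonnegative, so its expectation is taken in \<open>[0, \<infinity>]\<close>, where
  it always exists.\<close>

definition minimax_excess_risk ::
  "nat \<Rightarrow> ((real ^ 'd) \<times> real) measure set \<Rightarrow> ennreal" where
  "minimax_excess_risk n \<P> =
     (INF b \<in> estimators n. SUP P \<in> \<P>.
        \<integral>\<^sup>+ S. ennreal (excess_risk P (b S)) \<partial>(PiM {1..n} (\<lambda>_. P)))"

text \<open>Leverage score of the last of \<open>X 1, ..., X m\<close>; \<open>matrix_inv\<close> is the inverse only where
  the matrix is invertible, which under the theorem's assumptions holds almost surely.\<close>

definition leverage :: "nat \<Rightarrow> (nat \<Rightarrow> real ^ 'd) \<Rightarrow> real" where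
  "leverage m X = (matrix_inv (\<Sum>i = 1..m. outer (X i)) *v X m) \<bullet> X m"

end

theory Submission
  imports Defs
begin

text \<open>Write \<open>G = \<Sum>\<^sub>i X\<^sub>i X\<^sub>i\<^sup>T\<close> for the Gram matrix of the first \<open>n\<close> covariates and \<open>x\<close> for an independent
copy of \<open>X\<close>.  By the Sherman-Morrison identity the odds \<open>l / (1 - l)\<close> of the leverage score of
\<open>x = X\<^sub>n\<^sub>+\<^sub>1\<close> equal \<open>x \<bullet> G\<inverse> x\<close> (lemma \<open>leverage_odds\<close>), so both minimax risks have to be shown equal to
\<open>\<sigma>\<^sup>2 E[x \<bullet> G\<inverse> x]\<close>.  Since a Gaussian model is well specified, it suffices to bound the larger class
from above and the smaller one from below.

The excess risk of \<open>b\<close> is \<open>E[((b - \<beta>) \<bullet> x)\<^sup>2]\<close> with the true parameter \<open>\<beta>\<close>, because the noise is orthogonal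
to every function of \<open>X\<close>.  Keeping the test point \<open>x\<close> fixed and integrating over it at the very end
turns every step into a statement about scalars; traces and square roots of \<open>\<Sigma>\<close> never appear.

\<^emph>\<open>Upper bound.\<close>  Least squares predicts at \<open>x\<close> with error \<open>\<Sum>\<^sub>i (w \<bullet> X\<^sub>i) \<epsilon>\<^sub>i\<close>, where \<open>w = G\<inverse> x\<close>.  Given the
covariates, distinct noise terms are uncorrelated with variance at most \<open>\<sigma>\<^sup>2\<close>, and
\<open>\<Sum>\<^sub>i (w \<bullet> X\<^sub>i)\<^sup>2 = w \<bullet> G w = x \<bullet> w\<close>.  Non-degeneracy and \<open>n \<ge> d\<close> make \<open>G\<close> almost surely invertible
(lemmas \<open>noise_combination_second_moment_le\<close> and \<open>AE_det_gram_nonzero\<close>).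

\<^emph>\<open>Lower bound.\<close>  The supremum over \<open>\<beta>\<close> is at least the average under a Gaussian prior of variance
\<open>\<tau>\<^sup>2\<close>.  For each sample the function \<open>H = prior \<cdot> likelihood\<close> of \<open>\<beta>\<close> is the exponential of a quadratic
polynomial, and a Chapman-Robbins argument (translate \<open>H\<close> by \<open>t u\<close>, complete a square, let \<open>t\<close> tend
to 0) bounds \<open>\<integral>((b - \<beta>) \<bullet> x)\<^sup>2 H(\<beta>) d\<beta>\<close> from below by \<open>(2 x \<bullet> u - s) \<integral>H\<close>, for every direction \<open>u\<close> and with
\<open>s\<close> the curvature of \<open>-log H\<close> along \<open>u\<close>.  The choice \<open>u = \<sigma>\<^sup>2 w\<close> gives
\<open>\<sigma>\<^sup>2 x \<bullet> w - \<sigma>\<^sup>4 |w|\<^sup>2 / \<tau>\<^sup>2\<close>, which tends to \<open>\<sigma>\<^sup>2 x \<bullet> w\<close> as \<open>\<tau>\<close> grows, and Fatou's lemma passes to the limit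
(lemmas \<open>chapman_robbins\<close>, \<open>bayes_bound_le_sup_risk\<close> and \<open>prediction_variance_le_sup_risk\<close>).
In this form the posterior mean, ridge regression and the inverse of \<open>G + \<lambda> I\<close> are never computed.\<close>

section \<open>Gram matrices and leverage\<close>

text \<open>Cramer's rule as a total function: it is a rational expression in the entries, hence measurable, and
division by zero makes it return 0 for a singular matrix.  Both properties fail to be evident for
\<open>matrix_inv\<close>.\<close>
definition cramer_solve :: "real ^ 'd ^ 'd \<Rightarrow> real ^ 'd \<Rightarrow> real ^ 'd" where
  "cramer_solve A b = (\<chi> k. det (\<chi> i j. if j = k then b $ i else A $ i $ j) / det A)"

lemma cramer_solve_eq_iff:
  assumes "det A \<noteq> 0"
  shows "A *v x = b \<longleftrightarrow> x = cramer_solve A b"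
  using cramer[OF assms] by (simp add: cramer_solve_def)

lemma cramer_solve_singular: "det A = 0 \<Longrightarrow> cramer_solve A b = 0"
  by (simp add: cramer_solve_def vec_eq_iff)

lemma matrix_inv_eq_cramer_solve:
  fixes A :: "real ^ 'd ^ 'd"
  assumes "det A \<noteq> 0"
  shows "matrix_inv A *v b = cramer_solve A b"
proof -
  have "invertible A" using assms by (simp add: invertible_det_nz)
  then have "A ** matrix_inv A = mat 1"
    unfolding matrix_inv_def invertible_def by (rule someI2_ex) simp
  then have "A *v (matrix_inv A *v b) = b"
    by (simp add: matrix_vector_mul_assoc)
  then show ?thesis using cramer_solve_eq_iff[OF assms] by blast
qed

lemma borel_measurable_det [measurable]:
  fixes f :: "'a \<Rightarrow> real ^ 'd ^ 'd"
  assumes "\<And>i j. (\<lambda>x. f x $ i $ j) \<in> borel_measurable M"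
  shows "(\<lambda>x. det (f x)) \<in> borel_measurable M"
  unfolding det_def using assms by measurable

lemma borel_measurable_vec_lambda:
  fixes f :: "'a \<Rightarrow> real ^ 'd"
  assumes "\<And>i. (\<lambda>x. f x $ i) \<in> borel_measurable M"
  shows "f \<in> borel_measurable M"
proof (subst borel_measurable_euclidean_space, intro ballI)
  fix b :: "real ^ 'd" assume "b \<in> Basis"
  then obtain i where "b = axis i 1" by (auto simp: Basis_vec_def)
  then show "(\<lambda>x. f x \<bullet> b) \<in> borel_measurable M" using assms by (simp add: inner_axis)
qed

lemma measurable_vec_nth [measurable]: "(\<lambda>x. x $ i) \<in> borel_measurable (borel :: (real ^ 'd) measure)"
  by (intro borel_measurable_continuous_onI continuous_intros)

definition gram :: "'i set \<Rightarrow> ('i \<Rightarrow> real ^ 'd) \<Rightarrow> real ^ 'd ^ 'd" where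
  "gram I X = (\<Sum>i\<in>I. outer (X i))"

lemma gram_mult: "gram I X *v v = (\<Sum>i\<in>I. (X i \<bullet> v) *\<^sub>R X i)"
  by (simp add: vec_eq_iff gram_def outer_def matrix_vector_mult_def inner_vec_def
      sum_distrib_right sum_distrib_left algebra_simps sum.swap[of _ I UNIV])

lemma inner_gram: "u \<bullet> (gram I X *v v) = (\<Sum>i\<in>I. (u \<bullet> X i) * (v \<bullet> X i))"
  by (simp add: gram_mult inner_sum_right inner_commute mult.commute)

lemma borel_measurable_cramer_solve_gram:
  assumes "\<And>i. i \<in> I \<Longrightarrow> f i \<in> borel_measurable M" and "g \<in> borel_measurable M"
  shows "(\<lambda>z. cramer_solve (gram I (\<lambda>i. f i z)) (g z)) \<in> borel_measurable M"
proof -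
  note [measurable] = assms
  have nth: "(\<lambda>z. gram I (\<lambda>i. f i z) $ j $ k) \<in> borel_measurable M" for j k
  proof -
    have "(\<lambda>z. gram I (\<lambda>i. f i z) $ j $ k) = (\<lambda>z. \<Sum>i\<in>I. f i z $ j * f i z $ k)"
      by (simp add: gram_def outer_def)
    also have "\<dots> \<in> borel_measurable M"
      by measurable
    finally show ?thesis .
  qed
  have "(\<lambda>z. det (\<chi> i j. if j = k then g z $ i else gram I (\<lambda>i. f i z) $ i $ j)) \<in> borel_measurable M" for k
  proof (rule borel_measurable_det)
    fix i j
    show "(\<lambda>z. (\<chi> i j. if j = k then g z $ i else gram I (\<lambda>i. f i z) $ i $ j) $ i $ j) \<in> borel_measurable M"
      by (cases "j = k") (simp_all add: nth)
  qed
  moreover have "(\<lambda>z. det (gram I (\<lambda>i. f i z))) \<in> borel_measurable M"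
    by (rule borel_measurable_det) (rule nth)
  ultimately show ?thesis
    unfolding cramer_solve_def by (intro borel_measurable_vec_lambda) simp
qed

text \<open>With \<open>w = G\<inverse> x\<close> this is \<open>w \<bullet> G w = w \<bullet> x\<close>.  It also holds for singular \<open>G\<close>, where the solution is 0, so
the bounds below need no case distinction on invertibility.\<close>
lemma sum_sq_cramer_solve_gram:
  "(\<Sum>i\<in>I. (cramer_solve (gram I X) x \<bullet> X i)\<^sup>2) = x \<bullet> cramer_solve (gram I X) x"
proof (cases "det (gram I X) = 0")
  case False
  let ?w = "cramer_solve (gram I X) x"
  have "gram I X *v ?w = x" using cramer_solve_eq_iff[OF False] by blast
  then have "?w \<bullet> x = (\<Sum>i\<in>I. (?w \<bullet> X i) * (?w \<bullet> X i))" using inner_gram[of ?w I X ?w] by simp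
  then show ?thesis by (simp add: power2_eq_square inner_commute)
qed (simp add: cramer_solve_singular)

text \<open>\<open>G\<close> is positive semidefinite with \<open>v \<bullet> G v = \<Sum>\<^sub>i (v \<bullet> X\<^sub>i)\<^sup>2\<close>, so its kernel consists of the vectors that are
orthogonal to every \<open>X\<^sub>i\<close>.\<close>
lemma det_gram_nonzero_iff:
  assumes "finite I"
  shows "det (gram I X) \<noteq> 0 \<longleftrightarrow> (\<forall>v. (\<forall>i\<in>I. v \<bullet> X i = 0) \<longrightarrow> v = 0)"
proof -
  have "(gram I X *v v = 0) \<longleftrightarrow> (\<forall>i\<in>I. v \<bullet> X i = 0)" for v
  proof
    assume "gram I X *v v = 0"
    then have "(\<Sum>i\<in>I. (v \<bullet> X i)\<^sup>2) = 0" using inner_gram[of v I X v] by (simp add: power2_eq_square)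
    then show "\<forall>i\<in>I. v \<bullet> X i = 0" using assms by (subst (asm) sum_nonneg_eq_0_iff) auto
  qed (simp add: gram_mult inner_commute)
  then show ?thesis
    using matrix_left_invertible_ker[of "gram I X"] invertible_det_nz[of "gram I X"]
    by (auto simp: invertible_left_inverse)
qed

text \<open>Sherman-Morrison for the solution only: if \<open>G w = x\<close> and \<open>h = x \<bullet> w\<close>, then
\<open>(G + x x\<^sup>T) w = (1 + h) x\<close>.  Hence the leverage is \<open>h / (1 + h)\<close>, whose odds are \<open>h\<close>.\<close>
lemma leverage_odds:
  fixes X :: "nat \<Rightarrow> real ^ 'd"
  assumes "det (gram {1..n} X) \<noteq> 0"
  shows "leverage (n + 1) X / (1 - leverage (n + 1) X) = X (n + 1) \<bullet> cramer_solve (gram {1..n} X) (X (n + 1))"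
proof -
  let ?x = "X (n + 1)" and ?G = "gram {1..n} X" and ?T = "gram {1..n + 1} X"
  let ?w = "cramer_solve ?G ?x"
  define h where "h = ?x \<bullet> ?w"
  have T: "?T *v v = ?G *v v + (?x \<bullet> v) *\<^sub>R ?x" for v
    by (simp add: gram_mult)
  have h0: "h \<ge> 0" unfolding h_def sum_sq_cramer_solve_gram[symmetric] by (intro sum_nonneg) auto
  have ker: "\<forall>v. (\<forall>i\<in>{1..n}. v \<bullet> X i = 0) \<longrightarrow> v = 0"
    using assms by (subst (asm) det_gram_nonzero_iff) auto
  have "det ?T \<noteq> 0"
    by (subst det_gram_nonzero_iff) (use ker in \<open>auto\<close>)
  moreover have "?T *v ((1 / (1 + h)) *\<^sub>R ?w) = ?x"
  proof -
    have "?G *v ?w = ?x" using cramer_solve_eq_iff[OF assms] by blast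
    then have "?T *v ?w = (1 + h) *\<^sub>R ?x" by (simp only: T h_def scaleR_left_distrib scaleR_one)
    then show ?thesis using h0 by (simp add: matrix_vector_mult_scaleR)
  qed
  ultimately have "matrix_inv ?T *v ?x = (1 / (1 + h)) *\<^sub>R ?w"
    using cramer_solve_eq_iff matrix_inv_eq_cramer_solve by metis
  then have "leverage (n + 1) X = h / (1 + h)"
    by (simp add: leverage_def gram_def h_def inner_commute)
  moreover have "1 - h / (1 + h) = 1 / (1 + h)" using h0 by (simp add: field_simps)
  ultimately have "leverage (n + 1) X / (1 - leverage (n + 1) X) = h" using h0 by simp
  then show ?thesis unfolding h_def .
qed

section \<open>Almost sure invertibility of the Gram matrix\<close>

text \<open>Replacing one coordinate of an i.i.d. sample by a fresh independent copy does not change its law.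
This is how one coordinate is integrated out while the index set of the sample stays the same.\<close>
lemma PiM_resample_coordinate:
  assumes "prob_space P" "finite I" "j \<in> I"
  shows "distr (PiM I (\<lambda>_. P) \<Otimes>\<^sub>M P) (PiM I (\<lambda>_. P)) (\<lambda>(S, z). S(j := z)) = PiM I (\<lambda>_. P)"
proof -
  interpret Q: prob_space P by fact
  interpret PP: product_prob_space "\<lambda>_. P" I ..
  interpret R: prob_space "PiM I (\<lambda>_. P)" by (rule prob_space_PiM) (rule assms)
  have ins: "insert j I = I" using assms by auto
  have [measurable]: "(\<lambda>(S, z). S(j := z)) \<in> PiM I (\<lambda>_. P) \<Otimes>\<^sub>M P \<rightarrow>\<^sub>M PiM I (\<lambda>_. P)"
    using measurable_add_dim[of j I "\<lambda>_. P"] unfolding ins .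
  show ?thesis
  proof (rule PP.PiM_eqI)
    fix A :: "'b \<Rightarrow> 'a set" assume A: "\<And>i. i \<in> I \<Longrightarrow> A i \<in> sets P"
    then have [measurable]: "Pi\<^sub>E I A \<in> sets (PiM I (\<lambda>_. P))"
      using assms(2) by (intro sets_PiM_I_finite) auto
    let ?A' = "\<lambda>i. if i = j then space P else A i"
    have "(\<lambda>(S, z). S(j := z)) -` Pi\<^sub>E I A \<inter> space (PiM I (\<lambda>_. P) \<Otimes>\<^sub>M P) = Pi\<^sub>E I ?A' \<times> A j"
      using assms(3) sets.sets_into_space[OF A]
      by (auto simp: space_pair_measure space_PiM PiE_iff extensional_def split: if_splits) (metis subsetD)+
    then have "emeasure (distr (PiM I (\<lambda>_. P) \<Otimes>\<^sub>M P) (PiM I (\<lambda>_. P)) (\<lambda>(S, z). S(j := z))) (Pi\<^sub>E I A)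
        = emeasure (PiM I (\<lambda>_. P) \<Otimes>\<^sub>M P) (Pi\<^sub>E I ?A' \<times> A j)"
      by (simp add: emeasure_distr)
    also have "\<dots> = emeasure (PiM I (\<lambda>_. P)) (Pi\<^sub>E I ?A') * emeasure P (A j)"
      using A assms by (intro Q.emeasure_pair_measure_Times sets_PiM_I_finite) auto
    also have "\<dots> = (\<Prod>i\<in>I. emeasure P (?A' i)) * emeasure P (A j)"
      using A assms(2) by (subst PP.emeasure_PiM) auto
    also have "\<dots> = (\<Prod>i\<in>I. emeasure P (A i))"
      using assms by (simp add: prod.remove[of I j] Q.emeasure_space_1 mult.commute)
    finally show "emeasure (distr (PiM I (\<lambda>_. P) \<Otimes>\<^sub>M P) (PiM I (\<lambda>_. P)) (\<lambda>(S, z). S(j := z))) (Pi\<^sub>E I A)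
        = (\<Prod>i\<in>I. emeasure P (A i))" .
  qed (use assms in auto)
qed

lemma
  assumes "prob_space P" "finite I" "j \<in> I"
  shows nn_integral_PiM_resample: "F \<in> borel_measurable (PiM I (\<lambda>_. P)) \<Longrightarrow>
      (\<integral>\<^sup>+S. F S \<partial>PiM I (\<lambda>_. P)) = (\<integral>\<^sup>+S. \<integral>\<^sup>+z. F (S(j := z)) \<partial>P \<partial>PiM I (\<lambda>_. P))"
    and integral_PiM_resample: "integrable (PiM I (\<lambda>_. P)) f \<Longrightarrow>
      (\<integral>S. f S \<partial>PiM I (\<lambda>_. P)) = (\<integral>S. \<integral>z. f (S(j := z) :: 'i \<Rightarrow> 'a) \<partial>P \<partial>PiM I (\<lambda>_. P) :: real)"
proof -
  interpret Q: prob_space P by fact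
  interpret R: prob_space "PiM I (\<lambda>_. P)" by (rule prob_space_PiM) (rule assms)
  interpret RP: pair_sigma_finite "PiM I (\<lambda>_. P)" P ..
  have ins: "insert j I = I" using assms by auto
  have upd [measurable]: "(\<lambda>(S, z). S(j := z)) \<in> PiM I (\<lambda>_. P) \<Otimes>\<^sub>M P \<rightarrow>\<^sub>M PiM I (\<lambda>_. P)"
    using measurable_add_dim[of j I "\<lambda>_. P"] unfolding ins .
  note eq = PiM_resample_coordinate[OF assms]
  {
    assume [measurable]: "F \<in> borel_measurable (PiM I (\<lambda>_. P))"
    have "(\<integral>\<^sup>+S. F S \<partial>PiM I (\<lambda>_. P)) = (\<integral>\<^sup>+w. F (case w of (S, z) \<Rightarrow> S(j := z)) \<partial>(PiM I (\<lambda>_. P) \<Otimes>\<^sub>M P))"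
      by (subst (1) eq[symmetric]) (rule nn_integral_distr, auto)
    also have "\<dots> = (\<integral>\<^sup>+S. \<integral>\<^sup>+z. F (S(j := z)) \<partial>P \<partial>PiM I (\<lambda>_. P))"
      by (subst Q.nn_integral_fst[symmetric]) auto
    finally show "(\<integral>\<^sup>+S. F S \<partial>PiM I (\<lambda>_. P)) = (\<integral>\<^sup>+S. \<integral>\<^sup>+z. F (S(j := z)) \<partial>P \<partial>PiM I (\<lambda>_. P))" .
  next
    assume f: "integrable (PiM I (\<lambda>_. P)) f"
    then have [measurable]: "f \<in> borel_measurable (PiM I (\<lambda>_. P))" by auto
    have "(\<integral>S. f S \<partial>PiM I (\<lambda>_. P)) = (\<integral>w. f (case w of (S, z) \<Rightarrow> S(j := z)) \<partial>(PiM I (\<lambda>_. P) \<Otimes>\<^sub>M P))"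
      by (subst (1) eq[symmetric]) (rule integral_distr, auto)
    also have "\<dots> = (\<integral>w. (case w of (S, z) \<Rightarrow> f (S(j := z))) \<partial>(PiM I (\<lambda>_. P) \<Otimes>\<^sub>M P))"
      by (simp add: case_prod_beta)
    also have "\<dots> = (\<integral>S. \<integral>z. f (S(j := z)) \<partial>P \<partial>PiM I (\<lambda>_. P))"
    proof (subst RP.integral_fst)
      have "integrable (PiM I (\<lambda>_. P) \<Otimes>\<^sub>M P) (\<lambda>w. f (case w of (S, z) \<Rightarrow> S(j := z)))"
        by (rule integrable_distr[OF upd]) (use f eq in simp)
      then show "integrable (PiM I (\<lambda>_. P) \<Otimes>\<^sub>M P) (\<lambda>(S, z). f (S(j := z)))"
        by (simp add: case_prod_beta')
    qed simp
    finally show "(\<integral>S. f S \<partial>PiM I (\<lambda>_. P)) = (\<integral>S. \<integral>z. f (S(j := z)) \<partial>P \<partial>PiM I (\<lambda>_. P))" .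
  }
qed

lemma AE_not_orthogonal:
  fixes PX :: "(real ^ 'd) measure"
  assumes "prob_space PX" "sets PX = sets borel" "\<not> degenerate PX" "\<theta> \<noteq> 0"
  shows "AE x in PX. \<theta> \<bullet> x \<noteq> 0"
proof -
  interpret prob_space PX by fact
  note [measurable_cong] = assms(2)
  let ?t = "\<theta> /\<^sub>R norm \<theta>"
  have "norm ?t = 1" using assms(4) by simp
  then have "measure PX {x \<in> space PX. ?t \<bullet> x = 0} = 0"
    using assms(3) unfolding degenerate_def by (metis measure_nonneg order_le_less)
  then have "AE x in PX. ?t \<bullet> x \<noteq> 0"
    by (subst AE_iff_measurable[OF _ refl]) (auto simp: emeasure_eq_measure)
  then show ?thesis by eventually_elim auto
qed

text \<open>As a function of a single row the determinant is linear, hence an inner product with a fixed vector.\<close>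
lemma det_row_eq_inner:
  fixes c :: "'d::finite \<Rightarrow> real ^ 'd"
  obtains \<theta> where "\<And>x. det (\<chi> i. if i = k then x else c i) = \<theta> \<bullet> x"
proof
  fix x :: "real ^ 'd"
  let ?D = "\<lambda>x. det (\<chi> i. if i = k then x else c i)"
  have "?D x = ?D (\<Sum>j\<in>UNIV. x $ j *s axis j 1)" by (subst basis_expansion) (rule refl)
  also have "\<dots> = (\<Sum>j\<in>UNIV. ?D (x $ j *s axis j 1))"
    using det_linear_row_sum[of UNIV k "\<lambda>i j. x $ j *s axis j 1" c] by simp
  also have "\<dots> = (\<Sum>j\<in>UNIV. x $ j * ?D (axis j 1))"
    using det_row_mul[of k _ "\<lambda>i. axis _ 1" c] by simp
  finally show "?D x = (\<chi> j. ?D (axis j 1)) \<bullet> x" by (simp add: inner_vec_def mult.commute)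
qed

text \<open>It is enough that some \<open>d\<close> of the vectors are linearly independent.  Start from the identity matrix and
replace its rows one after the other by sample points: the determinant is the inner product of the new
row with a vector that does not depend on it.  This vector is nonzero, because its inner
product with the row being replaced is the previous determinant, so by non-degeneracy the new determinant almost surely does not vanish.\<close>
lemma AE_det_gram_nonzero:
  fixes PX :: "(real ^ 'd) measure" and I :: "'i set"
  assumes "prob_space PX" "sets PX = sets borel" "\<not> degenerate PX"
    and "finite I" "J \<subseteq> I" "CARD('d) \<le> card J"
  shows "AE X in PiM I (\<lambda>_. PX). det (gram J X) \<noteq> 0"
proof -
  have finJ: "finite J" using assms finite_subset by auto
  note [measurable_cong] = assms(2)
  obtain f :: "'d \<Rightarrow> 'i" where f: "inj f" "range f \<subseteq> J"
    using card_le_inj[of "UNIV :: 'd set" J] assms finJ by auto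
  define B :: "'d set \<Rightarrow> ('i \<Rightarrow> real ^ 'd) \<Rightarrow> real ^ 'd ^ 'd"
    where "B F X = (\<chi> i. if i \<in> F then X (f i) else axis i 1)" for F X
  have meas [measurable]: "(\<lambda>X. det (B F X)) \<in> borel_measurable (PiM I (\<lambda>_. PX))" for F
  proof (rule borel_measurable_det)
    fix i j
    have "f i \<in> J" using f(2) rangeI[of f i] by (rule subsetD)
    then have "f i \<in> I" using assms(5) by (rule subsetD[rotated])
    then have "(\<lambda>X. X (f i)) \<in> PiM I (\<lambda>_. PX) \<rightarrow>\<^sub>M PX"
      by (rule measurable_component_singleton)
    then have "(\<lambda>X. X (f i) $ j) \<in> borel_measurable (PiM I (\<lambda>_. PX))"
      by (rule measurable_compose) measurable
    then show "(\<lambda>X. B F X $ i $ j) \<in> borel_measurable (PiM I (\<lambda>_. PX))"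
      by (cases "i \<in> F") (simp_all add: B_def)
  qed
  have "AE X in PiM I (\<lambda>_. PX). det (B F X) \<noteq> 0" for F
  proof (induction rule: finite_induct[OF finite[of F]])
    case 1
    have "B {} X = mat 1" for X by (simp add: B_def vec_eq_iff mat_def axis_def)
    then show ?case by simp
  next
    case (2 k F)
    let ?Z = "{X \<in> space (PiM I (\<lambda>_. PX)). det (B (insert k F) X) = 0}"
    have fk: "f k \<in> I" using f assms by auto
    have "emeasure (PiM I (\<lambda>_. PX)) ?Z = (\<integral>\<^sup>+X. indicator ?Z X \<partial>PiM I (\<lambda>_. PX))"
      by (rule nn_integral_indicator[symmetric]) measurable
    also have "\<dots> = (\<integral>\<^sup>+X. \<integral>\<^sup>+x. indicator ?Z (X(f k := x)) \<partial>PX \<partial>PiM I (\<lambda>_. PX))"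
      by (rule nn_integral_PiM_resample[OF assms(1,4) fk]) measurable
    also have "\<dots> = (\<integral>\<^sup>+X. 0 \<partial>PiM I (\<lambda>_. PX))"
    proof (rule nn_integral_cong_AE)
      show "AE X in PiM I (\<lambda>_. PX). (\<integral>\<^sup>+x. indicator ?Z (X(f k := x)) \<partial>PX) = 0"
        using 2(3)
      proof eventually_elim
        case (elim X)
        obtain \<theta> where \<theta>: "\<And>x. det (\<chi> i. if i = k then x else B F X $ i) = \<theta> \<bullet> x"
          using det_row_eq_inner[of k "\<lambda>i. B F X $ i"] by blast
        have upd: "B (insert k F) (X(f k := x)) = (\<chi> i. if i = k then x else B F X $ i)" for x
          using f(1) by (auto simp: B_def vec_eq_iff inj_eq)
        have "(\<chi> i. if i = k then axis k 1 else B F X $ i) = B F X"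
          using 2(2) by (auto simp: B_def vec_eq_iff)
        then have "\<theta> \<bullet> axis k 1 \<noteq> 0" using elim \<theta>[of "axis k 1"] by simp
        then have "\<theta> \<noteq> 0" by auto
        from AE_not_orthogonal[OF assms(1-3) this]
        have "AE x in PX. (indicator ?Z (X(f k := x)) :: ennreal) = 0"
          by eventually_elim (auto simp: upd \<theta> indicator_def)
        then show ?case by (rule nn_integral_zero')
      qed
    qed
    finally show ?case by (subst AE_iff_measurable[OF _ refl]) auto
  qed
  from this[of UNIV] show ?thesis
  proof eventually_elim
    case (elim X)
    show ?case
    proof (subst det_gram_nonzero_iff[OF finJ], intro allI impI)
      fix v :: "real ^ 'd" assume v: "\<forall>i\<in>J. v \<bullet> X i = 0"
      have "B UNIV X *v v = 0"
        using v f(2) by (auto simp: B_def vec_eq_iff matrix_vector_mult_def inner_vec_def mult.commute)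
      then show "v = 0"
        using elim invertible_det_nz[of "B UNIV X"] matrix_left_invertible_ker[of "B UNIV X"]
        by (auto simp: invertible_left_inverse)
    qed
  qed
qed

section \<open>Noise given the covariates\<close>
lemma joint_law_sets: "joint_law PX P \<Longrightarrow> sets P = sets (borel \<Otimes>\<^sub>M borel)"
  unfolding borel_prod by (simp add: joint_law_def)

lemma measurable_noise [measurable]: "noise \<beta> \<in> borel_measurable (borel \<Otimes>\<^sub>M borel)"
  unfolding noise_def by measurable

lemma joint_law_subalgebra:
  assumes "joint_law PX P"
  shows "sigma_finite_subalgebra P (sigma_X P)"
proof (rule finite_measure_subalgebra_is_sigma_finite)
  interpret prob_space P using assms by (simp add: joint_law_def)
  note [measurable_cong] = joint_law_sets[OF assms]
  show "finite_measure_subalgebra P (sigma_X P)"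
  proof
    show "subalgebra P (sigma_X P)"
      unfolding subalgebra_def sigma_X_def by (auto simp: sets_vimage_algebra2)
  qed
qed

lemma measurable_sigma_X:
  assumes "g \<in> borel \<rightarrow>\<^sub>M N"
  shows "(\<lambda>z. g (fst z)) \<in> sigma_X P \<rightarrow>\<^sub>M N"
  unfolding sigma_X_def using assms by (auto intro!: measurable_compose[OF _ assms] measurable_vimage_algebra1)

text \<open>For nonnegative integrable functions the extended and the real conditional expectation agree.  The
former satisfies the defining identity against every nonnegative measurable weight, even if the weighted
function has infinite integral.\<close>
lemma nn_cond_exp_eq_real_cond_exp:
  assumes "sigma_finite_subalgebra M F" "integrable M f" "\<And>x. f x \<ge> 0"
  shows "AE x in M. nn_cond_exp M F f x = ennreal (real_cond_exp M F f x)"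
proof -
  interpret sigma_finite_subalgebra M F by fact
  have [measurable]: "f \<in> borel_measurable M" using assms(2) by auto
  have "(\<integral>\<^sup>+x. nn_cond_exp M F f x \<partial>M) = (\<integral>\<^sup>+x. f x \<partial>M)"
    using nn_cond_exp_intg[of "\<lambda>_. 1" "\<lambda>x. ennreal (f x)"] by simp
  also have "\<dots> < \<infinity>" using assms(2,3) by (simp add: integrable_iff_bounded)
  finally have "AE x in M. nn_cond_exp M F f x \<noteq> \<infinity>"
    by (intro nn_integral_PInf_AE) auto
  moreover have "(\<lambda>x. ennreal (- f x)) = (\<lambda>_. 0)" using assms(3) by (simp add: fun_eq_iff ennreal_neg)
  then have "(\<integral>\<^sup>+x. nn_cond_exp M F (\<lambda>x. ennreal (- f x)) x \<partial>M) = 0"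
    using nn_cond_exp_intg[of "\<lambda>_. 1" "\<lambda>x. ennreal (- f x)"] by simp
  then have "AE x in M. nn_cond_exp M F (\<lambda>x. ennreal (- f x)) x = 0"
    by (subst (asm) nn_integral_0_iff_AE) auto
  ultimately show ?thesis
    by eventually_elim (simp add: real_cond_exp_def top.not_eq_extremum)
qed

text \<open>The two moment conditions on the noise in the integrated form in which they are used: \<open>E[\<epsilon> | X] = 0\<close> tested
against all weights, where the integral is 0 by convention if the product is not integrable, and
\<open>E[\<epsilon>\<^sup>2 | X] \<le> \<sigma>\<^sup>2\<close> tested against nonnegative weights.\<close>
definition noise_moments :: "real \<Rightarrow> ((real ^ 'd) \<times> real) measure \<Rightarrow> real ^ 'd \<Rightarrow> bool" where
  "noise_moments \<sigma> P \<beta> \<longleftrightarrow>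
     (\<forall>g \<in> borel_measurable borel. (\<integral>z. g (fst z) * noise \<beta> z \<partial>P) = 0) \<and>
     (\<forall>g \<in> borel_measurable borel. (\<integral>\<^sup>+z. g (fst z) * ennreal ((noise \<beta> z)\<^sup>2) \<partial>P) \<le> ennreal (\<sigma>\<^sup>2) * (\<integral>\<^sup>+z. g (fst z) \<partial>P))"

lemma noise_momentsI:
  fixes P :: "((real ^ 'd) \<times> real) measure"
  assumes jl: "joint_law PX P" and int: "integrable P (\<lambda>z. (noise \<beta> z)\<^sup>2)"
    and m1: "AE z in P. real_cond_exp P (sigma_X P) (noise \<beta>) z = 0"
    and m2: "AE z in P. real_cond_exp P (sigma_X P) (\<lambda>z. (noise \<beta> z)\<^sup>2) z \<le> \<sigma>\<^sup>2"
  shows "noise_moments \<sigma> P \<beta>"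
proof -
  interpret sigma_finite_subalgebra P "sigma_X P" by (rule joint_law_subalgebra[OF jl])
  note [measurable_cong] = joint_law_sets[OF jl]
  have "(\<integral>z. g (fst z) * noise \<beta> z \<partial>P) = 0" if g: "g \<in> borel_measurable borel" for g :: "real ^ 'd \<Rightarrow> real"
  proof (cases "integrable P (\<lambda>z. g (fst z) * noise \<beta> z)")
    case True
    have "(\<integral>z. g (fst z) * noise \<beta> z \<partial>P) = (\<integral>z. g (fst z) * real_cond_exp P (sigma_X P) (noise \<beta>) z \<partial>P)"
      by (rule real_cond_exp_intg(2)[symmetric, OF True measurable_sigma_X[OF g]]) measurable
    also have "\<dots> = 0"
      by (rule integral_eq_zero_AE) (use m1 in eventually_elim, simp)
    finally show ?thesis .
  qed (rule not_integrable_integral_eq)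
  moreover have "(\<integral>\<^sup>+z. g (fst z) * ennreal ((noise \<beta> z)\<^sup>2) \<partial>P) \<le> ennreal (\<sigma>\<^sup>2) * (\<integral>\<^sup>+z. g (fst z) \<partial>P)"
    if g [measurable]: "g \<in> borel_measurable borel" for g :: "real ^ 'd \<Rightarrow> ennreal"
  proof -
    have "(\<integral>\<^sup>+z. g (fst z) * ennreal ((noise \<beta> z)\<^sup>2) \<partial>P)
        = (\<integral>\<^sup>+z. g (fst z) * nn_cond_exp P (sigma_X P) (\<lambda>z. ennreal ((noise \<beta> z)\<^sup>2)) z \<partial>P)"
      by (rule nn_cond_exp_intg[symmetric, OF measurable_sigma_X[OF g]]) measurable
    also have "\<dots> \<le> (\<integral>\<^sup>+z. ennreal (\<sigma>\<^sup>2) * g (fst z) \<partial>P)"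
    proof (rule nn_integral_mono_AE)
      have "AE z in P. nn_cond_exp P (sigma_X P) (\<lambda>z. ennreal ((noise \<beta> z)\<^sup>2)) z
          = ennreal (real_cond_exp P (sigma_X P) (\<lambda>z. (noise \<beta> z)\<^sup>2) z)"
        by (rule nn_cond_exp_eq_real_cond_exp[OF sigma_finite_subalgebra_axioms int]) simp
      then show "AE z in P. g (fst z) * nn_cond_exp P (sigma_X P) (\<lambda>z. ennreal ((noise \<beta> z)\<^sup>2)) z
          \<le> ennreal (\<sigma>\<^sup>2) * g (fst z)"
        using m2 by eventually_elim (simp add: mult.commute[of "g _"] mult_right_mono ennreal_leI)
    qed
    also have "\<dots> = ennreal (\<sigma>\<^sup>2) * (\<integral>\<^sup>+z. g (fst z) \<partial>P)"
      by (rule nn_integral_cmult) measurable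
    finally show ?thesis .
  qed
  ultimately show ?thesis unfolding noise_moments_def by blast
qed

lemma noise_momentsD:
  assumes "noise_moments \<sigma> P \<beta>"
  shows "g \<in> borel_measurable borel \<Longrightarrow> (\<integral>z. g (fst z) * noise \<beta> z \<partial>P) = 0"
    and "h \<in> borel_measurable borel \<Longrightarrow>
      (\<integral>\<^sup>+z. h (fst z) * ennreal ((noise \<beta> z)\<^sup>2) \<partial>P) \<le> ennreal (\<sigma>\<^sup>2) * (\<integral>\<^sup>+z. h (fst z) \<partial>P)"
  using assms unfolding noise_moments_def by auto

lemma P_well_noise_moments:
  assumes "P \<in> P_well PX \<sigma>"
  obtains \<beta> where "joint_law PX P" "integrable P (\<lambda>z. (noise \<beta> z)\<^sup>2)" "noise_moments \<sigma> P \<beta>"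
  using assms noise_momentsI unfolding P_well_def by blast

lemma joint_law_nn_integral_fst:
  assumes "joint_law PX P" "g \<in> borel_measurable borel"
  shows "(\<integral>\<^sup>+z. g (fst z) \<partial>P) = (\<integral>\<^sup>+x. g x \<partial>PX)"
proof -
  note [measurable_cong] = joint_law_sets[OF assms(1)]
  have "PX = distr P borel fst" using assms(1) by (simp add: joint_law_def)
  then show ?thesis using assms(2) by (simp add: nn_integral_distr)
qed

lemma abs_mult_le_sum_squares: "\<bar>a * b\<bar> \<le> a\<^sup>2 + b\<^sup>2" for a b :: real
proof -
  have "2 * \<bar>a\<bar> * \<bar>b\<bar> \<le> a\<^sup>2 + b\<^sup>2" using sum_squares_bound[of "\<bar>a\<bar>" "\<bar>b\<bar>"] by simp
  moreover have "0 \<le> \<bar>a\<bar> * \<bar>b\<bar>" by simp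
  ultimately show ?thesis unfolding abs_mult by linarith
qed

text \<open>The risk splits as \<open>E[\<epsilon>\<^sup>2] + E[((b - \<beta>) \<bullet> X)\<^sup>2]\<close>, since the cross term \<open>E[((b - \<beta>) \<bullet> X) \<epsilon>]\<close> vanishes.  Hence
\<open>\<beta>\<close> minimizes the risk, and every minimizer, in particular the one selected by \<open>beta_star\<close>, has the
same risk as \<open>\<beta>\<close>.\<close>
lemma excess_risk_eq:
  assumes jl: "joint_law PX P" and int: "integrable P (\<lambda>z. (noise \<beta> z)\<^sup>2)" and mom: "noise_moments \<sigma> P \<beta>"
    and sq: "integrable PX (\<lambda>x. (norm x)\<^sup>2)"
  shows "ennreal (excess_risk P b) = (\<integral>\<^sup>+x. ennreal (((b - \<beta>) \<bullet> x)\<^sup>2) \<partial>PX)"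
proof -
  note [measurable_cong] = joint_law_sets[OF jl]
  have PX: "PX = distr P borel fst" using jl by (simp add: joint_law_def)
  have sq': "integrable P (\<lambda>z. (norm (fst z))\<^sup>2)"
    using sq unfolding PX by (subst (asm) integrable_distr_eq) auto
  have lin: "integrable P (\<lambda>z. (v \<bullet> fst z)\<^sup>2)" for v
  proof (rule Bochner_Integration.integrable_bound)
    show "integrable P (\<lambda>z. (norm v)\<^sup>2 * (norm (fst z))\<^sup>2)" using sq' by simp
    show "AE z in P. norm ((v \<bullet> fst z)\<^sup>2) \<le> norm ((norm v)\<^sup>2 * (norm (fst z))\<^sup>2)"
      using Cauchy_Schwarz_ineq[of v] by (simp add: power2_norm_eq_inner)
  qed measurable
  have cross: "integrable P (\<lambda>z. (v \<bullet> fst z) * noise \<beta> z)" for v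
  proof (rule Bochner_Integration.integrable_bound)
    show "integrable P (\<lambda>z. (v \<bullet> fst z)\<^sup>2 + (noise \<beta> z)\<^sup>2)" using lin int by simp
    show "AE z in P. norm ((v \<bullet> fst z) * noise \<beta> z) \<le> norm ((v \<bullet> fst z)\<^sup>2 + (noise \<beta> z)\<^sup>2)"
      using abs_mult_le_sum_squares by simp
  qed measurable
  have zero: "(\<integral>z. (v \<bullet> fst z) * noise \<beta> z \<partial>P) = 0" for v
    using mom unfolding noise_moments_def by (auto elim!: ballE[where x = "\<lambda>x. v \<bullet> x"])
  have risk: "risk P b = (\<integral>z. (noise \<beta> z)\<^sup>2 \<partial>P) + (\<integral>z. ((b - \<beta>) \<bullet> fst z)\<^sup>2 \<partial>P)" for b
  proof -
    have "risk P b = (\<integral>z. (noise \<beta> z)\<^sup>2 - 2 * (((b - \<beta>) \<bullet> fst z) * noise \<beta> z) + ((b - \<beta>) \<bullet> fst z)\<^sup>2 \<partial>P)"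
      unfolding risk_def noise_def
      by (rule Bochner_Integration.integral_cong) (auto simp: power2_eq_square algebra_simps inner_diff_left)
    also have "\<dots> = (\<integral>z. (noise \<beta> z)\<^sup>2 \<partial>P) - 2 * (\<integral>z. ((b - \<beta>) \<bullet> fst z) * noise \<beta> z \<partial>P)
        + (\<integral>z. ((b - \<beta>) \<bullet> fst z)\<^sup>2 \<partial>P)"
      using int lin cross by simp
    finally show ?thesis by (simp add: zero)
  qed
  have "risk P (beta_star P) = risk P \<beta>"
    unfolding beta_star_def by (rule arg_min_equality) (auto simp: risk)
  then have "ennreal (excess_risk P b) = ennreal (\<integral>z. ((b - \<beta>) \<bullet> fst z)\<^sup>2 \<partial>P)"
    by (simp add: excess_risk_def risk)
  also have "\<dots> = (\<integral>\<^sup>+z. ennreal (((b - \<beta>) \<bullet> fst z)\<^sup>2) \<partial>P)"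
    by (rule nn_integral_eq_integral[symmetric, OF lin]) simp
  also have "\<dots> = (\<integral>\<^sup>+x. ennreal (((b - \<beta>) \<bullet> x)\<^sup>2) \<partial>PX)"
    by (rule joint_law_nn_integral_fst[OF jl]) measurable
  finally show ?thesis .
qed

abbreviation gauss :: "real \<Rightarrow> real measure" where
  "gauss \<sigma> \<equiv> density lborel (\<lambda>e. ennreal (normal_density 0 \<sigma> e))"

text \<open>If noise and covariates are independent, conditional expectations of functions of the noise are
constants.  The indicator functions give membership in the Gaussian class, the first two powers give
the moment conditions of the well-specified class.\<close>
lemma real_cond_exp_independent_noise:
  assumes jl: "joint_law PX P" and law: "distr P (borel \<Otimes>\<^sub>M borel) (\<lambda>z. (fst z, noise \<beta> z)) = PX \<Otimes>\<^sub>M N"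
    and N: "prob_space N" "sets N = sets borel" and f: "integrable N f"
  shows "integrable P (\<lambda>z. f (noise \<beta> z))"
    "AE z in P. real_cond_exp P (sigma_X P) (\<lambda>z. f (noise \<beta> z)) z = (\<integral>e. f e \<partial>N :: real)"
proof -
  interpret prob_space P using jl by (simp add: joint_law_def)
  interpret N: prob_space N by fact
  note [measurable_cong] = joint_law_sets[OF jl] N(2)
  interpret sigma_finite_subalgebra P "sigma_X P" by (rule joint_law_subalgebra[OF jl])
  have PX: "distr P borel fst = PX" using jl by (simp add: joint_law_def)
  interpret PX: prob_space PX unfolding PX[symmetric] by (rule prob_space_distr) measurable
  have [measurable_cong]: "sets PX = sets borel" unfolding PX[symmetric] by simp
  have [measurable]: "f \<in> borel_measurable borel" using f N(2) by (auto cong: measurable_cong_sets)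
  interpret XN: pair_sigma_finite PX N ..
  have snd: "distr (PX \<Otimes>\<^sub>M N) N snd = N"
  proof (rule measure_eqI)
    fix A assume "A \<in> sets (distr (PX \<Otimes>\<^sub>M N) N snd)"
    then have [measurable]: "A \<in> sets N" by simp
    have "snd -` A \<inter> space (PX \<Otimes>\<^sub>M N) = space PX \<times> A"
      using sets.sets_into_space[of A N] by (auto simp: space_pair_measure)
    then show "emeasure (distr (PX \<Otimes>\<^sub>M N) N snd) A = emeasure N A"
      by (simp add: emeasure_distr N.emeasure_pair_measure_Times PX.emeasure_space_1)
  qed simp
  have intf: "integrable (PX \<Otimes>\<^sub>M N) (\<lambda>w. f (snd w))"
    by (rule integrable_distr[where M' = N]) (use f snd in auto)
  then have "integrable (distr P (borel \<Otimes>\<^sub>M borel) (\<lambda>z. (fst z, noise \<beta> z))) (\<lambda>w. f (snd w))"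
    unfolding law .
  then show int: "integrable P (\<lambda>z. f (noise \<beta> z))"
    by (subst (asm) integrable_distr_eq) auto
  show "AE z in P. real_cond_exp P (sigma_X P) (\<lambda>z. f (noise \<beta> z)) z = (\<integral>e. f e \<partial>N)"
  proof (rule real_cond_exp_charact[OF _ int])
    fix A assume "A \<in> sets (sigma_X P)"
    then obtain B where B [measurable]: "B \<in> sets borel" and A: "A = fst -` B \<inter> space P"
      unfolding sigma_X_def by (subst (asm) sets_vimage_algebra2) auto
    have "(\<integral>z\<in>A. f (noise \<beta> z) \<partial>P) = (\<integral>z. indicator B (fst z) * f (noise \<beta> z) \<partial>P)"
      unfolding set_lebesgue_integral_def A
      by (rule Bochner_Integration.integral_cong) (auto simp: indicator_def)
    also have "\<dots> = (\<integral>w. indicator B (fst w) * f (snd w) \<partial>(PX \<Otimes>\<^sub>M N))"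
      unfolding law[symmetric] by (subst integral_distr) auto
    also have "\<dots> = (\<integral>x. \<integral>e. indicator B x * f e \<partial>N \<partial>PX)"
    proof (subst XN.integral_fst'[symmetric])
      show "integrable (PX \<Otimes>\<^sub>M N) (\<lambda>w. indicator B (fst w) * f (snd w))"
        by (rule Bochner_Integration.integrable_bound[OF intf]) (auto simp: indicator_def)
    qed simp
    also have "\<dots> = (\<integral>z. indicator B (fst z) * (\<integral>e. f e \<partial>N) \<partial>P)"
      by (subst PX[symmetric], subst integral_distr) auto
    also have "\<dots> = (\<integral>z\<in>A. (\<integral>e. f e \<partial>N) \<partial>P)"
      unfolding set_lebesgue_integral_def A
      by (rule Bochner_Integration.integral_cong) (auto simp: indicator_def)
    finally show "(\<integral>z\<in>A. f (noise \<beta> z) \<partial>P) = (\<integral>z\<in>A. (\<integral>e. f e \<partial>N) \<partial>P)" .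
  qed auto
qed

lemma prob_space_gauss: "\<sigma> > 0 \<Longrightarrow> prob_space (gauss \<sigma>)"
  by (rule prob_space_normal_density)

text \<open>Conversely, constant conditional probabilities force the law of covariates and noise to be a product,
because the two laws then agree on rectangles.\<close>
lemma P_Gauss_law:
  assumes "P \<in> P_Gauss PX \<sigma>" "\<sigma> > 0"
  obtains \<beta> where "joint_law PX P" "distr P (borel \<Otimes>\<^sub>M borel) (\<lambda>z. (fst z, noise \<beta> z)) = PX \<Otimes>\<^sub>M gauss \<sigma>"
proof -
  from assms obtain \<beta> where jl: "joint_law PX P"
    and c: "\<And>B. B \<in> sets borel \<Longrightarrow> AE z in P.
        real_cond_exp P (sigma_X P) (\<lambda>z. indicator B (noise \<beta> z)) z = measure (gauss \<sigma>) B"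
    unfolding P_Gauss_def by auto
  interpret prob_space P using jl by (simp add: joint_law_def)
  interpret N: prob_space "gauss \<sigma>" by (rule prob_space_gauss) fact
  note [measurable_cong] = joint_law_sets[OF jl]
  interpret sigma_finite_subalgebra P "sigma_X P" by (rule joint_law_subalgebra[OF jl])
  have PX: "distr P borel fst = PX" using jl by (simp add: joint_law_def)
  interpret PX: prob_space PX unfolding PX[symmetric] by (rule prob_space_distr) measurable
  have [measurable_cong]: "sets PX = sets borel" unfolding PX[symmetric] by simp
  have "PX \<Otimes>\<^sub>M gauss \<sigma> = distr P (borel \<Otimes>\<^sub>M borel) (\<lambda>z. (fst z, noise \<beta> z))"
  proof (rule pair_measure_eqI)
    show "sigma_finite_measure PX" "sigma_finite_measure (gauss \<sigma>)" by unfold_locales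
    show "sets (PX \<Otimes>\<^sub>M gauss \<sigma>) = sets (distr P (borel \<Otimes>\<^sub>M borel) (\<lambda>z. (fst z, noise \<beta> z)))"
      by (simp cong: sets_pair_measure_cong)
         (intro sets_pair_measure_cong, simp_all add: PX[symmetric])
    fix A B assume "A \<in> sets PX" "B \<in> sets (gauss \<sigma>)"
    then have [measurable]: "A \<in> sets borel" "B \<in> sets borel" by (simp_all add: PX[symmetric])
    have bnd: "integrable P (\<lambda>z. indicator A (fst z) * indicator B (noise \<beta> z) :: real)"
      by (rule integrable_const_bound[where B = 1]) (auto simp: indicator_def)
    have "measure P {z \<in> space P. fst z \<in> A \<and> noise \<beta> z \<in> B}
        = (\<integral>z. indicator {z \<in> space P. fst z \<in> A \<and> noise \<beta> z \<in> B} z \<partial>P)"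
      by simp
    also have "\<dots> = (\<integral>z. indicator A (fst z) * indicator B (noise \<beta> z) \<partial>P)"
      by (rule Bochner_Integration.integral_cong) (auto simp: indicator_def)
    also have "\<dots> = (\<integral>z. indicator A (fst z) * real_cond_exp P (sigma_X P) (\<lambda>z. indicator B (noise \<beta> z)) z \<partial>P)"
      by (rule real_cond_exp_intg(2)[symmetric, OF bnd measurable_sigma_X]) measurable
    also have "\<dots> = (\<integral>z. indicator A (fst z) * measure (gauss \<sigma>) B \<partial>P)"
      by (rule integral_cong_AE) (use c[of B] in \<open>auto\<close>)
    also have "\<dots> = (\<integral>z. indicator A (fst z) \<partial>P) * measure (gauss \<sigma>) B" by simp
    also have "(\<integral>z. indicator A (fst z) \<partial>P) = measure PX A"
      using integral_distr[of fst P borel "indicator A :: _ \<Rightarrow> real"] PX by simp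
    finally have "measure P {z \<in> space P. fst z \<in> A \<and> noise \<beta> z \<in> B} = measure PX A * measure (gauss \<sigma>) B" .
    moreover have "(\<lambda>z. (fst z, noise \<beta> z)) -` (A \<times> B) \<inter> space P = {z \<in> space P. fst z \<in> A \<and> noise \<beta> z \<in> B}"
      by auto
    ultimately show "emeasure PX A * emeasure (gauss \<sigma>) B
        = emeasure (distr P (borel \<Otimes>\<^sub>M borel) (\<lambda>z. (fst z, noise \<beta> z))) (A \<times> B)"
      by (subst emeasure_distr) (auto simp: emeasure_eq_measure PX.emeasure_eq_measure N.emeasure_eq_measure ennreal_mult)
  qed
  with jl that show ?thesis by metis
qed

lemma gauss_moments:
  assumes "\<sigma> > 0"
  shows "integrable (gauss \<sigma>) (\<lambda>e. e)" "(\<integral>e. e \<partial>gauss \<sigma>) = 0"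
    "integrable (gauss \<sigma>) (\<lambda>e. e\<^sup>2)" "(\<integral>e. e\<^sup>2 \<partial>gauss \<sigma>) = \<sigma>\<^sup>2"
proof -
  show "integrable (gauss \<sigma>) (\<lambda>e. e)"
    using integrable_normal_moment[of \<sigma> 0 1] assms by (subst integrable_density) auto
  show "integrable (gauss \<sigma>) (\<lambda>e. e\<^sup>2)"
    using integrable_normal_moment[of \<sigma> 0 2] assms by (subst integrable_density) auto
  show "(\<integral>e. e \<partial>gauss \<sigma>) = 0"
    using integral_normal_moment_odd[of \<sigma> 0 0] assms by (subst integral_density) auto
  show "(\<integral>e. e\<^sup>2 \<partial>gauss \<sigma>) = \<sigma>\<^sup>2"
    using integral_normal_moment_even[of \<sigma> 0 1] assms
    by (subst integral_density) (auto simp: numeral_2_eq_2)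
qed

lemma independent_gauss_noise:
  assumes jl: "joint_law PX P" and "\<sigma> > 0"
    and law: "distr P (borel \<Otimes>\<^sub>M borel) (\<lambda>z. (fst z, noise \<beta> z)) = PX \<Otimes>\<^sub>M gauss \<sigma>"
  shows "integrable P (\<lambda>z. (noise \<beta> z)\<^sup>2)"
    "AE z in P. real_cond_exp P (sigma_X P) (noise \<beta>) z = 0"
    "AE z in P. real_cond_exp P (sigma_X P) (\<lambda>z. (noise \<beta> z)\<^sup>2) z \<le> \<sigma>\<^sup>2"
proof -
  note cond = real_cond_exp_independent_noise[OF jl law prob_space_gauss[OF assms(2)]]
  note mom = gauss_moments[OF assms(2)]
  show "AE z in P. real_cond_exp P (sigma_X P) (noise \<beta>) z = 0"
    using cond(2)[of "\<lambda>e. e"] mom by simp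
  show "integrable P (\<lambda>z. (noise \<beta> z)\<^sup>2)"
    using cond(1)[of "\<lambda>e. e\<^sup>2"] mom by simp
  show "AE z in P. real_cond_exp P (sigma_X P) (\<lambda>z. (noise \<beta> z)\<^sup>2) z \<le> \<sigma>\<^sup>2"
    using cond(2)[of "\<lambda>e. e\<^sup>2", OF _ mom(3)] by (simp add: mom(4)) (elim eventually_mono, simp)
qed

lemma P_Gauss_subset_P_well:
  assumes "\<sigma> > 0"
  shows "P_Gauss PX \<sigma> \<subseteq> P_well PX \<sigma>"
proof
  fix P assume "P \<in> P_Gauss PX \<sigma>"
  then obtain \<beta> where jl: "joint_law PX P"
    and law: "distr P (borel \<Otimes>\<^sub>M borel) (\<lambda>z. (fst z, noise \<beta> z)) = PX \<Otimes>\<^sub>M gauss \<sigma>"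
    using P_Gauss_law[OF _ assms] by blast
  show "P \<in> P_well PX \<sigma>"
    using jl independent_gauss_noise[OF jl assms law] unfolding P_well_def by auto
qed

section \<open>The risk of least squares\<close>
lemma measurable_PiM_update:
  assumes "X \<in> space (PiM I M)" "i \<in> I"
  shows "(\<lambda>a. X(i := a)) \<in> M i \<rightarrow>\<^sub>M PiM I M"
proof -
  have "insert i I = I" using assms by auto
  then have "(\<lambda>(f, y). f(i := y)) \<in> PiM I M \<Otimes>\<^sub>M M i \<rightarrow>\<^sub>M PiM I M"
    using measurable_add_dim[of i I M] by simp
  from measurable_compose[OF measurable_Pair1'[OF assms(1)] this] show ?thesis by simp
qed

lemma compose_update: "i \<in> I \<Longrightarrow> compose I f (S(i := z)) = (compose I f S)(i := f z)"
  by (auto simp: compose_def)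

lemma measurable_compose_fst:
  assumes "sets P = sets (borel \<Otimes>\<^sub>M borel)"
  shows "compose I fst \<in> PiM I (\<lambda>_. P) \<rightarrow>\<^sub>M PiM I (\<lambda>_. borel)"
proof -
  note [measurable_cong] = assms
  show ?thesis unfolding compose_def by measurable
qed

text \<open>The covariates of a sample from a joint law form an i.i.d. sample from the law of \<open>X\<close>.\<close>
lemma nn_integral_covariates:
  assumes jl: "joint_law PX P" and "finite I" and g: "g \<in> borel_measurable (PiM I (\<lambda>_. borel))"
  shows "(\<integral>\<^sup>+S. g (compose I fst S) \<partial>PiM I (\<lambda>_. P)) = (\<integral>\<^sup>+X. g X \<partial>PiM I (\<lambda>_. PX))"
proof -
  note [measurable_cong] = joint_law_sets[OF jl]
  have P: "prob_space P" and PX: "PX = distr P borel fst" using jl by (simp_all add: joint_law_def)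
  have sPX: "sets PX = sets borel" unfolding PX by simp
  note [measurable_cong] = sPX
  have pX: "prob_space PX" unfolding PX by (rule prob_space.prob_space_distr[OF P]) measurable
  have "PX = distr P PX fst" by (subst (1) PX) (rule distr_cong, auto simp: sPX)
  then have "distr (PiM I (\<lambda>_. P)) (PiM I (\<lambda>_. PX)) (compose I fst) = PiM I (\<lambda>_. PX)"
    using distr_PiM_finite_prob_space'[of I "\<lambda>_. P" "\<lambda>_. PX" fst] assms(2) P pX by simp
  moreover have "sets (PiM I (\<lambda>_. PX)) = sets (PiM I (\<lambda>_. borel))"
    by (rule sets_PiM_cong) (simp_all add: sPX)
  ultimately show ?thesis
    using nn_integral_distr[of "compose I fst" "PiM I (\<lambda>_. P)" "PiM I (\<lambda>_. PX)" g] g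
      measurable_compose_fst[OF joint_law_sets[OF jl], of I]
    by (simp cong: measurable_cong_sets)
qed

text \<open>Given the covariates, the noise terms are centred and uncorrelated and have variance at most \<open>\<sigma>\<^sup>2\<close>.
Each term of the expanded square is integrated over its own observation first, with all others fixed.
The coefficients depend on all covariates, so this inner integral is one of \<open>noise_moments\<close> with a
weight that depends on the frozen observations.  If the right-hand side is finite, the squares are
integrable, and hence so are the cross terms.\<close>
lemma noise_combination_second_moment_le:
  fixes P :: "((real ^ 'd) \<times> real) measure" and c :: "'i \<Rightarrow> ('i \<Rightarrow> real ^ 'd) \<Rightarrow> real"
  assumes jl: "joint_law PX P" and mom: "noise_moments \<sigma> P \<beta>" and fin: "finite I"
    and c: "\<And>i. i \<in> I \<Longrightarrow> c i \<in> borel_measurable (PiM I (\<lambda>_. borel))"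
  shows "(\<integral>\<^sup>+S. ennreal ((\<Sum>i\<in>I. c i (compose I fst S) * noise \<beta> (S i))\<^sup>2) \<partial>PiM I (\<lambda>_. P))
      \<le> ennreal (\<sigma>\<^sup>2) * (\<integral>\<^sup>+X. ennreal (\<Sum>i\<in>I. (c i X)\<^sup>2) \<partial>PiM I (\<lambda>_. PX))"
proof -
  let ?PI = "PiM I (\<lambda>_. P)"
  note [measurable_cong] = joint_law_sets[OF jl]
  have P: "prob_space P" using jl by (simp add: joint_law_def)
  define C where "C i S = c i (compose I fst S)" for i and S :: "'i \<Rightarrow> (real ^ 'd) \<times> real"
  define W where "W i S = C i S * noise \<beta> (S i)" for i S
  have C [measurable]: "C i \<in> borel_measurable ?PI" if "i \<in> I" for i
    unfolding C_def using measurable_compose[OF measurable_compose_fst[OF joint_law_sets[OF jl]] c[OF that]] .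
  have W [measurable]: "W i \<in> borel_measurable ?PI" if "i \<in> I" for i
    using C[OF that] that unfolding W_def by measurable
  have upd: "(\<lambda>a. c i ((compose I fst S)(j := a))) \<in> borel_measurable borel"
    if "S \<in> space ?PI" "i \<in> I" "j \<in> I" for S i j
  proof -
    have "compose I fst S \<in> space (PiM I (\<lambda>_. borel :: (real ^ 'd) measure))"
      using measurable_space[OF measurable_compose_fst[OF joint_law_sets[OF jl]] that(1)] .
    from measurable_compose[OF measurable_PiM_update[OF this that(3)] c[OF that(2)]] show ?thesis .
  qed
  have diag: "(\<integral>\<^sup>+S. ennreal ((W i S)\<^sup>2) \<partial>?PI) \<le> ennreal (\<sigma>\<^sup>2) * (\<integral>\<^sup>+S. ennreal ((C i S)\<^sup>2) \<partial>?PI)"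
    if i: "i \<in> I" for i
  proof -
    have [measurable]: "W i \<in> borel_measurable ?PI" "C i \<in> borel_measurable ?PI" using i by auto
    have "(\<integral>\<^sup>+S. ennreal ((W i S)\<^sup>2) \<partial>?PI) = (\<integral>\<^sup>+S. \<integral>\<^sup>+z. ennreal ((W i (S(i := z)))\<^sup>2) \<partial>P \<partial>?PI)"
      by (rule nn_integral_PiM_resample[OF P fin i]) measurable
    also have "\<dots> \<le> (\<integral>\<^sup>+S. ennreal (\<sigma>\<^sup>2) * (\<integral>\<^sup>+z. ennreal ((C i (S(i := z)))\<^sup>2) \<partial>P) \<partial>?PI)"
    proof (rule nn_integral_mono)
      fix S assume S: "S \<in> space ?PI"
      let ?g = "\<lambda>a. ennreal ((c i ((compose I fst S)(i := a)))\<^sup>2)"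
      have "?g \<in> borel_measurable borel" using upd[OF S i i] by measurable
      then have "(\<integral>\<^sup>+z. ?g (fst z) * ennreal ((noise \<beta> z)\<^sup>2) \<partial>P) \<le> ennreal (\<sigma>\<^sup>2) * (\<integral>\<^sup>+z. ?g (fst z) \<partial>P)"
        by (rule noise_momentsD(2)[OF mom])
      then show "(\<integral>\<^sup>+z. ennreal ((W i (S(i := z)))\<^sup>2) \<partial>P) \<le> ennreal (\<sigma>\<^sup>2) * (\<integral>\<^sup>+z. ennreal ((C i (S(i := z)))\<^sup>2) \<partial>P)"
        by (simp add: W_def C_def compose_update[OF i] power_mult_distrib ennreal_mult)
    qed
    also have "\<dots> = ennreal (\<sigma>\<^sup>2) * (\<integral>\<^sup>+S. \<integral>\<^sup>+z. ennreal ((C i (S(i := z)))\<^sup>2) \<partial>P \<partial>?PI)"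
    proof (rule nn_integral_cmult)
      interpret prob_space P by fact
      have "insert i I = I" using i by auto
      then have [measurable]: "(\<lambda>(S, z). S(i := z)) \<in> ?PI \<Otimes>\<^sub>M P \<rightarrow>\<^sub>M ?PI"
        using measurable_add_dim[of i I "\<lambda>_. P"] by simp
      have "(\<lambda>w. ennreal ((C i (case w of (S, z) \<Rightarrow> S(i := z)))\<^sup>2)) \<in> borel_measurable (?PI \<Otimes>\<^sub>M P)"
        by measurable
      then show "(\<lambda>S. \<integral>\<^sup>+z. ennreal ((C i (S(i := z)))\<^sup>2) \<partial>P) \<in> borel_measurable ?PI"
        by (intro borel_measurable_nn_integral) (simp add: case_prod_beta')
    qed
    also have "(\<integral>\<^sup>+S. \<integral>\<^sup>+z. ennreal ((C i (S(i := z)))\<^sup>2) \<partial>P \<partial>?PI) = (\<integral>\<^sup>+S. ennreal ((C i S)\<^sup>2) \<partial>?PI)"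
      by (rule nn_integral_PiM_resample[OF P fin i, symmetric]) measurable
    finally show ?thesis .
  qed
  have off: "(\<integral>S. W i S * W j S \<partial>?PI) = 0" if i: "i \<in> I" and j: "j \<in> I" and ij: "i \<noteq> j" for i j
  proof (cases "integrable ?PI (\<lambda>S. W i S * W j S)")
    case True
    have "(\<integral>S. W i S * W j S \<partial>?PI) = (\<integral>S. \<integral>z. W i (S(j := z)) * W j (S(j := z)) \<partial>P \<partial>?PI)"
      by (rule integral_PiM_resample[OF P fin j True])
    also have "\<dots> = (\<integral>S. 0 \<partial>?PI)"
    proof (rule Bochner_Integration.integral_cong[OF refl])
      fix S assume S: "S \<in> space ?PI"
      let ?g = "\<lambda>a. c i ((compose I fst S)(j := a)) * c j ((compose I fst S)(j := a)) * noise \<beta> (S i)"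
      have "?g \<in> borel_measurable borel" using upd[OF S i j] upd[OF S j j] by measurable
      then have "(\<integral>z. ?g (fst z) * noise \<beta> z \<partial>P) = 0"
        by (rule noise_momentsD(1)[OF mom])
      then show "(\<integral>z. W i (S(j := z)) * W j (S(j := z)) \<partial>P) = 0"
        using ij by (simp add: W_def C_def compose_update[OF j] algebra_simps)
    qed
    finally show ?thesis by simp
  qed (rule not_integrable_integral_eq)
  have cX: "(\<integral>\<^sup>+X. ennreal (\<Sum>i\<in>I. (c i X)\<^sup>2) \<partial>PiM I (\<lambda>_. PX)) = (\<Sum>i\<in>I. \<integral>\<^sup>+S. ennreal ((C i S)\<^sup>2) \<partial>?PI)"
  proof -
    have "(\<integral>\<^sup>+X. ennreal (\<Sum>i\<in>I. (c i X)\<^sup>2) \<partial>PiM I (\<lambda>_. PX)) = (\<integral>\<^sup>+S. ennreal (\<Sum>i\<in>I. (C i S)\<^sup>2) \<partial>?PI)"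
      unfolding C_def
      by (rule nn_integral_covariates[OF jl fin, symmetric])
         (intro measurable_compose[OF _ measurable_ennreal] borel_measurable_sum borel_measurable_power c)
    also have "\<dots> = (\<integral>\<^sup>+S. (\<Sum>i\<in>I. ennreal ((C i S)\<^sup>2)) \<partial>?PI)" by (simp add: sum_ennreal)
    also have "\<dots> = (\<Sum>i\<in>I. \<integral>\<^sup>+S. ennreal ((C i S)\<^sup>2) \<partial>?PI)"
      by (rule nn_integral_sum) measurable
    finally show ?thesis .
  qed
  show ?thesis
  proof (cases "ennreal (\<sigma>\<^sup>2) * (\<integral>\<^sup>+X. ennreal (\<Sum>i\<in>I. (c i X)\<^sup>2) \<partial>PiM I (\<lambda>_. PX)) = \<infinity>")
    case False
    then have fin_sum: "(\<Sum>i\<in>I. ennreal (\<sigma>\<^sup>2) * (\<integral>\<^sup>+S. ennreal ((C i S)\<^sup>2) \<partial>?PI)) < \<infinity>"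
      by (simp add: cX sum_distrib_left top.not_eq_extremum)
    have sq: "integrable ?PI (\<lambda>S. (W i S)\<^sup>2)" if i: "i \<in> I" for i
    proof (rule integrableI_bounded)
      have "ennreal (\<sigma>\<^sup>2) * (\<integral>\<^sup>+S. ennreal ((C i S)\<^sup>2) \<partial>?PI) < \<infinity>"
        using fin_sum i fin
        by (intro order.strict_trans1[OF member_le_sum[of i I "\<lambda>i. ennreal (\<sigma>\<^sup>2) * (\<integral>\<^sup>+S. ennreal ((C i S)\<^sup>2) \<partial>?PI)"]]) auto
      then show "(\<integral>\<^sup>+S. ennreal (norm ((W i S)\<^sup>2)) \<partial>?PI) < \<infinity>"
        using diag[OF i] by (auto intro: order.strict_trans1)
    qed (use i in measurable)
    have prod: "integrable ?PI (\<lambda>S. W i S * W j S)" if i: "i \<in> I" and j: "j \<in> I" for i j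
    proof (rule Bochner_Integration.integrable_bound)
      show "integrable ?PI (\<lambda>S. (W i S)\<^sup>2 + (W j S)\<^sup>2)" using sq i j by simp
      show "AE S in ?PI. norm (W i S * W j S) \<le> norm ((W i S)\<^sup>2 + (W j S)\<^sup>2)" using abs_mult_le_sum_squares by simp
    qed (use i j in measurable)
    have expand: "(\<Sum>i\<in>I. W i S)\<^sup>2 = (\<Sum>i\<in>I. \<Sum>j\<in>I. W i S * W j S)" for S
      by (simp add: power2_eq_square sum_product)
    have int: "integrable ?PI (\<lambda>S. (\<Sum>i\<in>I. W i S)\<^sup>2)"
      unfolding expand by (intro Bochner_Integration.integrable_sum prod)
    have "(\<integral>S. (\<Sum>i\<in>I. W i S)\<^sup>2 \<partial>?PI) = (\<Sum>i\<in>I. \<Sum>j\<in>I. \<integral>S. W i S * W j S \<partial>?PI)"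
      unfolding expand by (subst Bochner_Integration.integral_sum)
        (auto intro!: Bochner_Integration.integrable_sum prod sum.cong Bochner_Integration.integral_sum)
    also have "\<dots> = (\<Sum>i\<in>I. \<integral>S. (W i S)\<^sup>2 \<partial>?PI)"
    proof (rule sum.cong[OF refl])
      fix i assume i: "i \<in> I"
      have "(\<Sum>j\<in>I. \<integral>S. W i S * W j S \<partial>?PI) = (\<Sum>j\<in>{i}. \<integral>S. W i S * W j S \<partial>?PI)"
        using fin i off[OF i] by (intro sum.mono_neutral_right) auto
      then show "(\<Sum>j\<in>I. \<integral>S. W i S * W j S \<partial>?PI) = (\<integral>S. (W i S)\<^sup>2 \<partial>?PI)"
        by (simp add: power2_eq_square)
    qed
    finally have eq: "(\<integral>S. (\<Sum>i\<in>I. W i S)\<^sup>2 \<partial>?PI) = (\<Sum>i\<in>I. \<integral>S. (W i S)\<^sup>2 \<partial>?PI)" .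
    have "(\<integral>\<^sup>+S. ennreal ((\<Sum>i\<in>I. W i S)\<^sup>2) \<partial>?PI) = (\<Sum>i\<in>I. ennreal (\<integral>S. (W i S)\<^sup>2 \<partial>?PI))"
      using nn_integral_eq_integral[OF int] by (simp add: eq sum_ennreal)
    also have "\<dots> = (\<Sum>i\<in>I. \<integral>\<^sup>+S. ennreal ((W i S)\<^sup>2) \<partial>?PI)"
      by (intro sum.cong refl nn_integral_eq_integral[symmetric] sq) auto
    also have "\<dots> \<le> (\<Sum>i\<in>I. ennreal (\<sigma>\<^sup>2) * (\<integral>\<^sup>+S. ennreal ((C i S)\<^sup>2) \<partial>?PI))"
      by (intro sum_mono diag)
    finally show ?thesis by (simp add: W_def C_def cX[unfolded C_def] sum_distrib_left)
  qed simp
qed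

text \<open>Up to the factor \<open>\<sigma>\<^sup>2\<close>, the mean variance of the least squares prediction at an independent test point.\<close>
definition prediction_variance :: "nat \<Rightarrow> (real ^ 'd) measure \<Rightarrow> ennreal" where
  "prediction_variance n PX =
     (\<integral>\<^sup>+x. \<integral>\<^sup>+X. ennreal (x \<bullet> cramer_solve (gram {1..n} X) x) \<partial>PiM {1..n} (\<lambda>_. PX) \<partial>PX)"

definition ols :: "nat \<Rightarrow> (nat \<Rightarrow> (real ^ 'd) \<times> real) \<Rightarrow> real ^ 'd" where
  "ols n S = cramer_solve (gram {1..n} (\<lambda>i. fst (S i))) (\<Sum>i=1..n. snd (S i) *\<^sub>R fst (S i))"

lemma ols_in_estimators: "ols n \<in> estimators n"
proof -
  have [measurable]: "(\<lambda>S :: nat \<Rightarrow> (real ^ 'd) \<times> real. fst (S i)) \<in> PiM {1..n} (\<lambda>_. borel) \<rightarrow>\<^sub>M borel"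
      "(\<lambda>S :: nat \<Rightarrow> (real ^ 'd) \<times> real. snd (S i)) \<in> PiM {1..n} (\<lambda>_. borel) \<rightarrow>\<^sub>M borel" if "i \<in> {1..n}" for i
    using that unfolding borel_prod[symmetric] by measurable
  show ?thesis
    unfolding estimators_def ols_def by (intro borel_measurable_cramer_solve_gram borel_measurable_sum) measurable
qed

lemma measurable_component_fst_snd:
  assumes "sets P = sets (borel \<Otimes>\<^sub>M borel)" "i \<in> I"
  shows "(\<lambda>S. fst (S i)) \<in> PiM I (\<lambda>_. P) \<rightarrow>\<^sub>M borel" "(\<lambda>S. snd (S i)) \<in> PiM I (\<lambda>_. P) \<rightarrow>\<^sub>M borel"
proof -
  note [measurable_cong] = assms(1)
  show "(\<lambda>S. fst (S i)) \<in> PiM I (\<lambda>_. P) \<rightarrow>\<^sub>M borel" "(\<lambda>S. snd (S i)) \<in> PiM I (\<lambda>_. P) \<rightarrow>\<^sub>M borel"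
    using assms(2) by measurable
qed

lemma gram_cong: "(\<And>i. i \<in> I \<Longrightarrow> X i = Y i) \<Longrightarrow> gram I X = gram I Y"
  by (simp add: gram_def)

lemma gram_compose: "gram I (compose I f S) = gram I (\<lambda>i. f (S i))"
  by (rule gram_cong) (simp add: compose_def)

lemma gram_update: "j \<notin> I \<Longrightarrow> gram I (X(j := x)) = gram I X"
  by (rule gram_cong) auto

text \<open>With \<open>G w = x\<close>, symmetry of \<open>G\<close> gives \<open>(b - \<beta>) \<bullet> x = w \<bullet> G (b - \<beta>)\<close>, and the normal equations turn
\<open>G (b - \<beta>)\<close> into the noise-weighted sum of the covariates.\<close>
lemma ols_prediction_error:
  assumes "det (gram {1..n} (\<lambda>i. fst (S i))) \<noteq> 0"
  shows "(ols n S - \<beta>) \<bullet> x =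
    (\<Sum>i=1..n. (cramer_solve (gram {1..n} (\<lambda>i. fst (S i))) x \<bullet> fst (S i)) * noise \<beta> (S i))"
proof -
  let ?G = "gram {1..n} (\<lambda>i. fst (S i))"
  let ?w = "cramer_solve ?G x"
  have w: "?G *v ?w = x" using cramer_solve_eq_iff[OF assms] by blast
  have "?G *v ols n S = (\<Sum>i=1..n. snd (S i) *\<^sub>R fst (S i))"
    using cramer_solve_eq_iff[OF assms] unfolding ols_def by blast
  then have "?G *v (ols n S - \<beta>) = (\<Sum>i=1..n. noise \<beta> (S i) *\<^sub>R fst (S i))"
    by (simp add: matrix_vector_mult_diff_distrib gram_mult noise_def inner_commute
        scaleR_left_diff_distrib sum_subtractf)
  moreover have "(ols n S - \<beta>) \<bullet> x = ?w \<bullet> (?G *v (ols n S - \<beta>))"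
    by (subst w[symmetric]) (simp add: inner_gram mult.commute)
  ultimately show ?thesis by (simp add: inner_sum_right mult.commute)
qed

lemma AE_covariates_det_gram_nonzero:
  fixes PX :: "(real ^ 'd) measure"
  assumes jl: "joint_law PX P" and nd: "\<not> degenerate PX" and n: "CARD('d) \<le> n"
  shows "AE S in PiM {1..n} (\<lambda>_. P). det (gram {1..n} (\<lambda>i. fst (S i))) \<noteq> 0"
proof -
  note [measurable_cong] = joint_law_sets[OF jl]
  have P: "prob_space P" and PX: "PX = distr P borel fst" using jl by (simp_all add: joint_law_def)
  have sPX: "sets PX = sets borel" unfolding PX by simp
  have pX: "prob_space PX" unfolding PX by (rule prob_space.prob_space_distr[OF P]) measurable
  have meas: "(\<lambda>X. det (gram {1..n} X)) \<in> borel_measurable (PiM {1..n} (\<lambda>_. borel :: (real ^ 'd) measure))"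
  proof (rule borel_measurable_det)
    fix j k
    have "(\<lambda>X. gram {1..n} X $ j $ k) = (\<lambda>X :: nat \<Rightarrow> real ^ 'd. \<Sum>i=1..n. X i $ j * X i $ k)"
      by (simp add: gram_def outer_def)
    also have "\<dots> \<in> borel_measurable (PiM {1..n} (\<lambda>_. borel))" by measurable
    finally show "(\<lambda>X. gram {1..n} X $ j $ k) \<in> borel_measurable (PiM {1..n} (\<lambda>_. borel :: (real ^ 'd) measure))" .
  qed
  let ?ind = "\<lambda>X :: nat \<Rightarrow> real ^ 'd. indicator {0} (det (gram {1..n} X)) :: ennreal"
  have ind: "?ind \<in> borel_measurable (PiM {1..n} (\<lambda>_. borel))" using meas by measurable
  have "AE X in PiM {1..n} (\<lambda>_. PX). ?ind X = 0"
    using AE_det_gram_nonzero[OF pX sPX nd, of "{1..n}" "{1..n}"] n by auto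
  then have "(\<integral>\<^sup>+S. ?ind (compose {1..n} fst S) \<partial>PiM {1..n} (\<lambda>_. P)) = 0"
    unfolding nn_integral_covariates[OF jl finite_atLeastAtMost ind] by (rule nn_integral_zero')
  then have "AE S in PiM {1..n} (\<lambda>_. P). ?ind (compose {1..n} fst S) = 0"
    using measurable_compose[OF measurable_compose_fst[OF joint_law_sets[OF jl], of "{1..n}"] ind]
    by (subst (asm) nn_integral_0_iff_AE)
  then show ?thesis by (auto simp: gram_compose elim!: eventually_mono split: split_indicator_asm)
qed

lemma ols_risk_le_prediction_variance:
  fixes PX :: "(real ^ 'd) measure"
  assumes P: "P \<in> P_well PX \<sigma>" and sq: "integrable PX (\<lambda>x. (norm x)\<^sup>2)"
    and nd: "\<not> degenerate PX" and n: "CARD('d) \<le> n"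
  shows "(\<integral>\<^sup>+S. ennreal (excess_risk P (ols n S)) \<partial>PiM {1..n} (\<lambda>_. P)) \<le> ennreal (\<sigma>\<^sup>2) * prediction_variance n PX"
proof -
  obtain \<beta> where jl: "joint_law PX P" and int: "integrable P (\<lambda>z. (noise \<beta> z)\<^sup>2)"
    and mom: "noise_moments \<sigma> P \<beta>" using P_well_noise_moments[OF P] .
  let ?PI = "PiM {1..n} (\<lambda>_. P)"
  note sP = joint_law_sets[OF jl]
  note [measurable_cong] = sP
  have pP: "prob_space P" and PX: "PX = distr P borel fst" using jl by (simp_all add: joint_law_def)
  have sPX [measurable_cong]: "sets PX = sets borel" unfolding PX by simp
  interpret PX: prob_space PX unfolding PX by (rule prob_space.prob_space_distr[OF pP]) measurable
  interpret PI: prob_space ?PI by (rule prob_space_PiM) (rule pP)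
  interpret pair_sigma_finite ?PI PX ..
  define c where "c x i X = cramer_solve (gram {1..n} X) x \<bullet> X i" for x i and X :: "nat \<Rightarrow> real ^ 'd"
  define E where "E S x = (\<Sum>i=1..n. c x i (\<lambda>i. fst (S i)) * noise \<beta> (S i))"
    for x and S :: "nat \<Rightarrow> (real ^ 'd) \<times> real"
  have E: "(\<lambda>w. E (fst w) (snd w)) \<in> borel_measurable (?PI \<Otimes>\<^sub>M PX)"
    unfolding E_def c_def noise_def
    by (intro borel_measurable_sum borel_measurable_times borel_measurable_inner borel_measurable_diff
        borel_measurable_const borel_measurable_cramer_solve_gram
        measurable_compose[OF measurable_fst measurable_component_fst_snd(1)[OF sP]]
        measurable_compose[OF measurable_fst measurable_component_fst_snd(2)[OF sP]]) (auto simp: sPX cong: measurable_cong_sets)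
  have "(\<integral>\<^sup>+S. ennreal (excess_risk P (ols n S)) \<partial>?PI) = (\<integral>\<^sup>+S. \<integral>\<^sup>+x. ennreal (((ols n S - \<beta>) \<bullet> x)\<^sup>2) \<partial>PX \<partial>?PI)"
    by (simp add: excess_risk_eq[OF jl int mom sq])
  also have "\<dots> = (\<integral>\<^sup>+S. \<integral>\<^sup>+x. ennreal ((E S x)\<^sup>2) \<partial>PX \<partial>?PI)"
    by (rule nn_integral_cong_AE, use AE_covariates_det_gram_nonzero[OF jl nd n] in eventually_elim)
       (simp add: ols_prediction_error E_def c_def)
  also have "\<dots> = (\<integral>\<^sup>+x. \<integral>\<^sup>+S. ennreal ((E S x)\<^sup>2) \<partial>?PI \<partial>PX)"
    by (rule Fubini'[symmetric]) (use E in \<open>simp add: case_prod_beta'\<close>)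
  also have "\<dots> \<le> (\<integral>\<^sup>+x. ennreal (\<sigma>\<^sup>2) * (\<integral>\<^sup>+X. ennreal (x \<bullet> cramer_solve (gram {1..n} X) x) \<partial>PiM {1..n} (\<lambda>_. PX)) \<partial>PX)"
  proof (rule nn_integral_mono)
    fix x
    have c: "c x i \<in> borel_measurable (PiM {1..n} (\<lambda>_. borel))" if "i \<in> {1..n}" for i
      unfolding c_def using that by (intro borel_measurable_inner borel_measurable_cramer_solve_gram) auto
    have "E S x = (\<Sum>i=1..n. c x i (compose {1..n} fst S) * noise \<beta> (S i))" for S
      unfolding E_def c_def gram_compose by (intro sum.cong) (auto simp: compose_def)
    moreover have "(\<Sum>i=1..n. (c x i X)\<^sup>2) = x \<bullet> cramer_solve (gram {1..n} X) x" for X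
      unfolding c_def by (rule sum_sq_cramer_solve_gram)
    ultimately show "(\<integral>\<^sup>+S. ennreal ((E S x)\<^sup>2) \<partial>?PI)
        \<le> ennreal (\<sigma>\<^sup>2) * (\<integral>\<^sup>+X. ennreal (x \<bullet> cramer_solve (gram {1..n} X) x) \<partial>PiM {1..n} (\<lambda>_. PX))"
      using noise_combination_second_moment_le[where c = "c x", OF jl mom finite_atLeastAtMost c] by simp
  qed
  also have "\<dots> = ennreal (\<sigma>\<^sup>2) * prediction_variance n PX"
    unfolding prediction_variance_def
  proof (rule nn_integral_cmult)
    interpret XI: prob_space "PiM {1..n} (\<lambda>_. PX)" by (rule prob_space_PiM) (rule PX.prob_space_axioms)
    have "(\<lambda>w. ennreal (fst w \<bullet> cramer_solve (gram {1..n} (\<lambda>i. snd w i)) (fst w)))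
        \<in> borel_measurable (PX \<Otimes>\<^sub>M PiM {1..n} (\<lambda>_. PX))"
      by (intro measurable_compose[OF _ measurable_ennreal] borel_measurable_inner borel_measurable_cramer_solve_gram)
         measurable
    then show "(\<lambda>x. \<integral>\<^sup>+X. ennreal (x \<bullet> cramer_solve (gram {1..n} X) x) \<partial>PiM {1..n} (\<lambda>_. PX)) \<in> borel_measurable PX"
      by (intro XI.borel_measurable_nn_integral) (simp add: case_prod_beta')
  qed
  finally show ?thesis .
qed

section \<open>A Chapman-Robbins bound\<close>
lemma
  fixes g :: "'a::euclidean_space \<Rightarrow> real"
  assumes "integrable lborel g"
  shows integrable_lborel_shift: "integrable lborel (\<lambda>v. g (v - c))"
    and integral_lborel_shift: "(\<integral>v. g (v - c) \<partial>lborel) = (\<integral>v. g v \<partial>lborel)"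
proof -
  have [measurable]: "g \<in> borel_measurable borel" using assms by auto
  have eq: "distr lborel borel (\<lambda>v. v - c) = lborel"
  proof -
    have "(\<lambda>v. v - c) = (+) (- c)" by (simp add: fun_eq_iff)
    then show ?thesis using lborel_distr_plus[of "- c"] by simp
  qed
  have "integrable (distr lborel borel (\<lambda>v. v - c)) g" unfolding eq by (rule assms)
  then show "integrable lborel (\<lambda>v. g (v - c))" by (subst (asm) integrable_distr_eq) auto
  have "(\<integral>v. g v \<partial>distr lborel borel (\<lambda>v. v - c)) = (\<integral>v. g (v - c) \<partial>lborel)"
    by (rule integral_distr) auto
  then show "(\<integral>v. g (v - c) \<partial>lborel) = (\<integral>v. g v \<partial>lborel)" unfolding eq by simp
qed

text \<open>Let \<open>f v = (b - v) \<bullet> x\<close> and \<open>r v = H (v - t u) / H v\<close>.  Integrating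
\<open>0 \<le> (f + (r - 1) / t)\<^sup>2 H\<close> gives the claim: by translation invariance the mixed term
\<open>\<integral>f (r - 1) H\<close> equals \<open>- t (x \<bullet> u) \<integral>H\<close>, and the assumption on \<open>H\<close> turns \<open>r\<^sup>2 H\<close> into a multiple of the
translate of \<open>H\<close> by \<open>2 t u\<close>.\<close>
lemma chapman_robbins_step:
  fixes H :: "'a::euclidean_space \<Rightarrow> real" and x u b :: 'a
  assumes pos: "\<And>v. H v > 0" and int: "integrable lborel H"
    and quad: "\<And>v. (H (v - t *\<^sub>R u))\<^sup>2 = exp (t\<^sup>2 * s) * H v * H (v - (2 * t) *\<^sub>R u)"
    and fin: "integrable lborel (\<lambda>v. ((b - v) \<bullet> x)\<^sup>2 * H v)" and t: "t \<noteq> 0"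
  shows "(2 * (x \<bullet> u) - (exp (t\<^sup>2 * s) - 1) / t\<^sup>2) * (\<integral>v. H v \<partial>lborel) \<le> (\<integral>v. ((b - v) \<bullet> x)\<^sup>2 * H v \<partial>lborel)"
proof -
  define f where "f v = (b - v) \<bullet> x" for v
  define Z where "Z = (\<integral>v. H v \<partial>lborel)"
  have [measurable]: "H \<in> borel_measurable borel" "f \<in> borel_measurable borel"
    using int unfolding f_def by auto
  have H1: "integrable lborel (\<lambda>v. H (v - t *\<^sub>R u))" "(\<integral>v. H (v - t *\<^sub>R u) \<partial>lborel) = Z"
    and H2: "integrable lborel (\<lambda>v. H (v - (2 * t) *\<^sub>R u))" "(\<integral>v. H (v - (2 * t) *\<^sub>R u) \<partial>lborel) = Z"
    unfolding Z_def by (rule integrable_lborel_shift[OF int] integral_lborel_shift[OF int])+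
  have f2H: "integrable lborel (\<lambda>v. (f v)\<^sup>2 * H v)" using fin by (simp add: f_def)
  have fH: "integrable lborel (\<lambda>v. f v * H v)"
  proof (rule Bochner_Integration.integrable_bound)
    show "integrable lborel (\<lambda>v. (f v)\<^sup>2 * H v + H v)" using f2H int by simp
    have "norm (f v * H v) \<le> norm ((f v)\<^sup>2 * H v + H v)" for v
    proof -
      have "\<bar>f v\<bar> * H v \<le> ((f v)\<^sup>2 + 1) * H v"
        using abs_mult_le_sum_squares[of "f v" 1] pos[of v] by (intro mult_right_mono) auto
      then show ?thesis using pos[of v] by (simp add: abs_mult algebra_simps)
    qed
    then show "AE v in lborel. norm (f v * H v) \<le> norm ((f v)\<^sup>2 * H v + H v)" by simp
  qed simp
  have shift: "f (v + t *\<^sub>R u) = f v - t * (x \<bullet> u)" for v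
    by (simp add: f_def algebra_simps inner_commute)
  have fs: "integrable lborel (\<lambda>v. f (v + t *\<^sub>R u) * H v)"
      "(\<integral>v. f (v + t *\<^sub>R u) * H v \<partial>lborel) = (\<integral>v. f v * H v \<partial>lborel) - t * (x \<bullet> u) * Z"
    using fH int by (simp_all add: shift Z_def left_diff_distrib mult.assoc)
  have fH1: "integrable lborel (\<lambda>v. f v * H (v - t *\<^sub>R u))"
      "(\<integral>v. f v * H (v - t *\<^sub>R u) \<partial>lborel) = (\<integral>v. f v * H v \<partial>lborel) - t * (x \<bullet> u) * Z"
    using integrable_lborel_shift[OF fs(1), of "t *\<^sub>R u"] integral_lborel_shift[OF fs(1), of "t *\<^sub>R u"] fs(2)
    by simp_all
  \<comment> \<open>\<open>?q\<close> is the expanded square; only in this form is each summand visibly integrable.\<close>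
  let ?q = "\<lambda>v. (f v)\<^sup>2 * H v + 2 / t * (f v * H (v - t *\<^sub>R u)) - 2 / t * (f v * H v)
      + 1 / t\<^sup>2 * (exp (t\<^sup>2 * s) * H (v - (2 * t) *\<^sub>R u) - 2 * H (v - t *\<^sub>R u) + H v)"
  have q: "?q v = (f v + 1 / t * (H (v - t *\<^sub>R u) / H v - 1))\<^sup>2 * H v" for v
  proof -
    have "exp (t\<^sup>2 * s) * H (v - (2 * t) *\<^sub>R u) = (H (v - t *\<^sub>R u))\<^sup>2 / H v"
      using quad[of v] pos[of v] by (simp add: field_simps)
    then show ?thesis using pos[of v] t by (simp add: field_simps power2_eq_square)
  qed
  have "0 \<le> (\<integral>v. ?q v \<partial>lborel)"
    unfolding q by (rule integral_nonneg_AE) (auto intro!: always_eventually mult_nonneg_nonneg less_imp_le[OF pos])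
  also have "\<dots> = (\<integral>v. (f v)\<^sup>2 * H v \<partial>lborel) - 2 * (x \<bullet> u) * Z + (exp (t\<^sup>2 * s) - 1) / t\<^sup>2 * Z"
  proof -
    have "(\<integral>v. ?q v \<partial>lborel) = (\<integral>v. (f v)\<^sup>2 * H v \<partial>lborel) + 2 / t * (\<integral>v. f v * H (v - t *\<^sub>R u) \<partial>lborel)
        - 2 / t * (\<integral>v. f v * H v \<partial>lborel) + 1 / t\<^sup>2 * (exp (t\<^sup>2 * s) * Z - 2 * Z + Z)"
      using f2H fH fH1(1) H1 H2 int by (simp add: Z_def)
    also have "\<dots> = (\<integral>v. (f v)\<^sup>2 * H v \<partial>lborel) - 2 * (x \<bullet> u) * Z + (exp (t\<^sup>2 * s) - 1) / t\<^sup>2 * Z"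
      unfolding fH1(2) using t by (simp add: field_simps)
    finally show ?thesis .
  qed
  finally show ?thesis by (simp add: Z_def f_def algebra_simps)
qed

text \<open>The limit \<open>t \<rightarrow> 0\<close> of the previous bound.  The assumption says that the second difference of \<open>log H\<close> along
\<open>u\<close> with step \<open>t\<close> is the constant \<open>- t\<^sup>2 s\<close>, as is the case for Gaussian densities.\<close>
lemma chapman_robbins:
  fixes H :: "'a::euclidean_space \<Rightarrow> real" and x u b :: 'a
  assumes pos: "\<And>v. H v > 0" and int: "integrable lborel H"
    and quad: "\<And>v t. (H (v - t *\<^sub>R u))\<^sup>2 = exp (t\<^sup>2 * s) * H v * H (v - (2 * t) *\<^sub>R u)"
  shows "ennreal (2 * (x \<bullet> u) - s) * (\<integral>\<^sup>+v. H v \<partial>lborel) \<le> (\<integral>\<^sup>+v. ennreal (((b - v) \<bullet> x)\<^sup>2 * H v) \<partial>lborel)"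
proof (cases "(\<integral>\<^sup>+v. ennreal (((b - v) \<bullet> x)\<^sup>2 * H v) \<partial>lborel) = \<infinity>")
  case False
  have [measurable]: "H \<in> borel_measurable borel" using int by auto
  have nonneg: "0 \<le> ((b - v) \<bullet> x)\<^sup>2 * H v" for v using pos[of v] by simp
  have fin: "integrable lborel (\<lambda>v. ((b - v) \<bullet> x)\<^sup>2 * H v)"
    using False nonneg by (intro integrableI_nonneg) (auto simp: top.not_eq_extremum)
  let ?Z = "\<integral>v. H v \<partial>lborel" and ?J = "\<integral>v. ((b - v) \<bullet> x)\<^sup>2 * H v \<partial>lborel"
  have "((\<lambda>r. exp (r * s)) has_real_derivative s) (at 0)"
    by (auto intro!: derivative_eq_intros)
  then have lim: "((\<lambda>r. (exp (r * s) - 1) / r) \<longlongrightarrow> s) (at 0)"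
    by (simp add: DERIV_def)
  have "filterlim (\<lambda>k. inverse (real (Suc k))) (at 0) sequentially"
    using LIMSEQ_inverse_real_of_nat by (auto simp: filterlim_at)
  from filterlim_compose[OF lim this]
  have "(\<lambda>k. (2 * (x \<bullet> u) - (exp (inverse (real (Suc k)) * s) - 1) / inverse (real (Suc k))) * ?Z)
      \<longlonglongrightarrow> (2 * (x \<bullet> u) - s) * ?Z"
    by (intro tendsto_intros)
  moreover have "(2 * (x \<bullet> u) - (exp (inverse (real (Suc k)) * s) - 1) / inverse (real (Suc k))) * ?Z \<le> ?J" for k
    \<comment> \<open>The step \<open>t = sqrt r\<close> makes the correction term the difference quotient of \<open>exp (r s)\<close> at 0.\<close>
    using chapman_robbins_step[OF pos int quad fin, of "sqrt (inverse (real (Suc k)))"] by simp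
  ultimately have "(2 * (x \<bullet> u) - s) * ?Z \<le> ?J" by (intro LIMSEQ_le_const2) auto
  moreover have "0 \<le> ?Z" using pos by (intro integral_nonneg_AE) (auto intro: less_imp_le)
  ultimately have "ennreal (2 * (x \<bullet> u) - s) * ennreal ?Z \<le> ennreal ?J"
    by (simp add: ennreal_mult''[symmetric] ennreal_leI)
  then show ?thesis
    using nn_integral_eq_integral[OF int] nn_integral_eq_integral[OF fin] pos nonneg by (simp add: less_imp_le)
qed simp

lemma PiM_density_const:
  assumes "sigma_finite_measure M" "sigma_finite_measure (density M f)" "finite I"
    and [measurable]: "f \<in> borel_measurable M"
  shows "PiM I (\<lambda>_. density M f) = density (PiM I (\<lambda>_. M)) (\<lambda>S. \<Prod>i\<in>I. f (S i))"
proof -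
  interpret D: product_sigma_finite "\<lambda>_. density M f" by (simp add: product_sigma_finite_def assms)
  interpret M: product_sigma_finite "\<lambda>_. M" by (simp add: product_sigma_finite_def assms)
  have "density (PiM I (\<lambda>_. M)) (\<lambda>S. \<Prod>i\<in>I. f (S i)) = PiM I (\<lambda>_. density M f)"
  proof (rule D.PiM_eqI[OF assms(3)])
    show "sets (density (PiM I (\<lambda>_. M)) (\<lambda>S. \<Prod>i\<in>I. f (S i))) = sets (PiM I (\<lambda>_. density M f))"
      by (simp, rule sets_PiM_cong) auto
    fix A assume "\<And>i. i \<in> I \<Longrightarrow> A i \<in> sets (density M f)"
    then have A: "\<And>i. i \<in> I \<Longrightarrow> A i \<in> sets M" by simp
    have [measurable]: "Pi\<^sub>E I A \<in> sets (PiM I (\<lambda>_. M))" using assms(3) A by (rule sets_PiM_I_finite)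
    have prod: "(\<lambda>S. \<Prod>i\<in>I. f (S i)) \<in> borel_measurable (PiM I (\<lambda>_. M))"
      by (intro borel_measurable_prod_ennreal) measurable
    have "emeasure (density (PiM I (\<lambda>_. M)) (\<lambda>S. \<Prod>i\<in>I. f (S i))) (Pi\<^sub>E I A)
        = (\<integral>\<^sup>+S. (\<Prod>i\<in>I. f (S i)) * indicator (Pi\<^sub>E I A) S \<partial>PiM I (\<lambda>_. M))"
      using prod by (simp add: emeasure_density)
    also have "\<dots> = (\<integral>\<^sup>+S. (\<Prod>i\<in>I. f (S i) * indicator (A i) (S i)) \<partial>PiM I (\<lambda>_. M))"
    proof (rule nn_integral_cong)
      fix S assume "S \<in> space (PiM I (\<lambda>_. M))"
      then have "indicator (Pi\<^sub>E I A) S = (\<Prod>i\<in>I. indicator (A i) (S i) :: ennreal)"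
        using assms(3) by (auto simp: indicator_def space_PiM PiE_iff prod_zero_iff split: if_splits)
      then show "(\<Prod>i\<in>I. f (S i)) * indicator (Pi\<^sub>E I A) S = (\<Prod>i\<in>I. f (S i) * indicator (A i) (S i))"
        by (simp add: prod.distrib)
    qed
    also have "\<dots> = (\<Prod>i\<in>I. \<integral>\<^sup>+z. f z * indicator (A i) z \<partial>M)"
      by (intro M.product_nn_integral_prod assms(3,4) borel_measurable_times_ennreal borel_measurable_indicator A)
    also have "\<dots> = (\<Prod>i\<in>I. emeasure (density M f) (A i))"
      by (intro prod.cong refl emeasure_density[symmetric] assms(4) A)
    finally show "emeasure (density (PiM I (\<lambda>_. M)) (\<lambda>S. \<Prod>i\<in>I. f (S i))) (Pi\<^sub>E I A)
        = (\<Prod>i\<in>I. emeasure (density M f) (A i))" .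
  qed
  then show ?thesis ..
qed

text \<open>In the location parameter \<open>v\<close>, \<open>-log\<close> of this density is quadratic with second derivative
\<open>(u \<bullet> z)\<^sup>2 / \<sigma>\<^sup>2\<close> along \<open>u\<close>.\<close>
lemma normal_density_second_difference:
  fixes u v z :: "'a::real_inner"
  assumes "\<sigma> > 0"
  shows "(normal_density ((v - t *\<^sub>R u) \<bullet> z) \<sigma> y)\<^sup>2
     = exp (t\<^sup>2 * ((u \<bullet> z)\<^sup>2 / \<sigma>\<^sup>2)) * normal_density (v \<bullet> z) \<sigma> y * normal_density ((v - (2 * t) *\<^sub>R u) \<bullet> z) \<sigma> y"
proof -
  define p q where "p = y - v \<bullet> z" and "q = u \<bullet> z"
  define C where "C = 1 / sqrt (2 * pi * \<sigma>\<^sup>2)"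
  have nd: "normal_density ((v - r *\<^sub>R u) \<bullet> z) \<sigma> y = C * exp (- (p + r * q)\<^sup>2 / (2 * \<sigma>\<^sup>2))" for r
    by (simp add: normal_density_def p_def q_def C_def inner_diff_left algebra_simps)
  have "exp (- (p + t * q)\<^sup>2 / (2 * \<sigma>\<^sup>2)) * exp (- (p + t * q)\<^sup>2 / (2 * \<sigma>\<^sup>2))
      = exp (t\<^sup>2 * (q\<^sup>2 / \<sigma>\<^sup>2)) * exp (- (p + 0 * q)\<^sup>2 / (2 * \<sigma>\<^sup>2)) * exp (- (p + 2 * t * q)\<^sup>2 / (2 * \<sigma>\<^sup>2))"
    unfolding exp_add[symmetric] using assms by (simp add: field_simps power2_eq_square)
  then show ?thesis
    using nd[of t] nd[of 0] nd[of "2 * t"] by (simp add: power2_eq_square q_def)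
qed

lemma prod_second_difference:
  fixes \<phi> :: "'j \<Rightarrow> 'a::real_vector \<Rightarrow> real"
  assumes "\<And>j. j \<in> J \<Longrightarrow> (\<phi> j (v - t *\<^sub>R u))\<^sup>2 = exp (t\<^sup>2 * s j) * \<phi> j v * \<phi> j (v - (2 * t) *\<^sub>R u)"
    and "finite J"
  shows "(\<Prod>j\<in>J. \<phi> j (v - t *\<^sub>R u))\<^sup>2
    = exp (t\<^sup>2 * (\<Sum>j\<in>J. s j)) * (\<Prod>j\<in>J. \<phi> j v) * (\<Prod>j\<in>J. \<phi> j (v - (2 * t) *\<^sub>R u))"
proof -
  have "(\<Prod>j\<in>J. \<phi> j (v - t *\<^sub>R u))\<^sup>2 = (\<Prod>j\<in>J. exp (t\<^sup>2 * s j) * \<phi> j v * \<phi> j (v - (2 * t) *\<^sub>R u))"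
    unfolding prod_power_distrib by (intro prod.cong refl assms(1))
  then show ?thesis using assms(2) by (simp add: sum_distrib_left exp_sum prod.distrib)
qed

section \<open>Gaussian models and their Bayes risk\<close>
definition gauss_model :: "(real ^ 'd) measure \<Rightarrow> real \<Rightarrow> real ^ 'd \<Rightarrow> ((real ^ 'd) \<times> real) measure" where
  "gauss_model PX \<sigma> \<beta> = distr (PX \<Otimes>\<^sub>M gauss \<sigma>) (borel \<Otimes>\<^sub>M borel) (\<lambda>(x, e). (x, \<beta> \<bullet> x + e))"

lemma
  fixes PX :: "(real ^ 'd) measure"
  assumes "prob_space PX" and sPX [measurable_cong]: "sets PX = sets borel" and "\<sigma> > 0"
  shows joint_law_gauss_model: "joint_law PX (gauss_model PX \<sigma> \<beta>)"
    and law_gauss_model: "distr (gauss_model PX \<sigma> \<beta>) (borel \<Otimes>\<^sub>M borel) (\<lambda>z. (fst z, noise \<beta> z)) = PX \<Otimes>\<^sub>M gauss \<sigma>"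
proof -
  interpret PX: prob_space PX by fact
  interpret N: prob_space "gauss \<sigma>" by (rule prob_space_gauss) fact
  interpret pair_prob_space PX "gauss \<sigma>" ..
  have "prob_space (gauss_model PX \<sigma> \<beta>)"
    unfolding gauss_model_def by (rule prob_space_distr) measurable
  moreover have "distr (gauss_model PX \<sigma> \<beta>) borel fst = PX"
  proof -
    have "distr (gauss_model PX \<sigma> \<beta>) borel fst = distr (PX \<Otimes>\<^sub>M gauss \<sigma>) PX fst"
      unfolding gauss_model_def by (subst distr_distr) (auto simp: comp_def case_prod_beta' sPX intro!: distr_cong)
    also have "\<dots> = PX" by (rule N.distr_pair_fst)
    finally show ?thesis .
  qed
  ultimately show "joint_law PX (gauss_model PX \<sigma> \<beta>)"
    by (simp add: joint_law_def) (simp add: gauss_model_def borel_prod)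
  have "distr (gauss_model PX \<sigma> \<beta>) (borel \<Otimes>\<^sub>M borel) (\<lambda>z. (fst z, noise \<beta> z))
      = distr (PX \<Otimes>\<^sub>M gauss \<sigma>) (PX \<Otimes>\<^sub>M gauss \<sigma>) (\<lambda>z. z)"
    unfolding gauss_model_def
  proof (subst distr_distr)
    show "distr (PX \<Otimes>\<^sub>M gauss \<sigma>) (borel \<Otimes>\<^sub>M borel) ((\<lambda>z. (fst z, noise \<beta> z)) \<circ> (\<lambda>(x, e). (x, \<beta> \<bullet> x + e)))
        = distr (PX \<Otimes>\<^sub>M gauss \<sigma>) (PX \<Otimes>\<^sub>M gauss \<sigma>) (\<lambda>z. z)"
      by (rule distr_cong) (auto simp: noise_def sPX intro!: sets_pair_measure_cong)
  qed measurable
  then show "distr (gauss_model PX \<sigma> \<beta>) (borel \<Otimes>\<^sub>M borel) (\<lambda>z. (fst z, noise \<beta> z)) = PX \<Otimes>\<^sub>M gauss \<sigma>"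
    by simp
qed

lemma gauss_model_in_P_Gauss:
  fixes PX :: "(real ^ 'd) measure"
  assumes "prob_space PX" "sets PX = sets borel" "\<sigma> > 0"
  shows "gauss_model PX \<sigma> \<beta> \<in> P_Gauss PX \<sigma>"
proof -
  interpret N: prob_space "gauss \<sigma>" by (rule prob_space_gauss) fact
  note jl = joint_law_gauss_model[OF assms, of \<beta>]
  have "AE z in gauss_model PX \<sigma> \<beta>. real_cond_exp (gauss_model PX \<sigma> \<beta>) (sigma_X (gauss_model PX \<sigma> \<beta>))
      (\<lambda>z. indicator B (noise \<beta> z)) z = measure (gauss \<sigma>) B" if "B \<in> sets borel" for B
  proof -
    have "integrable (gauss \<sigma>) (indicator B :: real \<Rightarrow> real)"
      using that by (intro N.integrable_const_bound[where B = 1]) (auto simp: indicator_def)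
    from real_cond_exp_independent_noise(2)[OF jl law_gauss_model[OF assms] N.prob_space_axioms _ this]
    show ?thesis using that by simp
  qed
  then show ?thesis unfolding P_Gauss_def using jl by auto
qed

lemma excess_risk_gauss_model:
  fixes PX :: "(real ^ 'd) measure"
  assumes "prob_space PX" "sets PX = sets borel" "\<sigma> > 0" "integrable PX (\<lambda>x. (norm x)\<^sup>2)"
  shows "ennreal (excess_risk (gauss_model PX \<sigma> \<beta>) b) = (\<integral>\<^sup>+x. ennreal (((b - \<beta>) \<bullet> x)\<^sup>2) \<partial>PX)"
proof -
  note jl = joint_law_gauss_model[OF assms(1-3), of \<beta>]
  note c = independent_gauss_noise[OF jl assms(3) law_gauss_model[OF assms(1-3)]]
  show ?thesis by (rule excess_risk_eq[OF jl c(1) noise_momentsI[OF jl c] assms(4)])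
qed

lemma nn_integral_lborel_shift:
  fixes g :: "real \<Rightarrow> ennreal"
  assumes "g \<in> borel_measurable borel"
  shows "(\<integral>\<^sup>+e. g (c + e) \<partial>lborel) = (\<integral>\<^sup>+y. g y \<partial>lborel)"
  by (subst (2) lborel_distr_plus[of c, symmetric], subst nn_integral_distr) (auto simp: assms)

text \<open>All Gaussian models are absolutely continuous with respect to the same measure, which does not depend
on \<open>\<beta>\<close>.  This is what allows the order of integration over parameter and sample to be exchanged.\<close>
lemma gauss_model_density:
  fixes PX :: "(real ^ 'd) measure"
  assumes "prob_space PX" and sPX [measurable_cong]: "sets PX = sets borel" and "\<sigma> > 0"
  shows "gauss_model PX \<sigma> \<beta>
    = density (PX \<Otimes>\<^sub>M lborel) (\<lambda>z. ennreal (normal_density (\<beta> \<bullet> fst z) \<sigma> (snd z)))"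
proof (rule measure_eqI)
  interpret PX: prob_space PX by fact
  interpret N: prob_space "gauss \<sigma>" by (rule prob_space_gauss) fact
  have nd [measurable]: "(\<lambda>z. normal_density (\<beta> \<bullet> fst z) \<sigma> (snd z)) \<in> borel_measurable (borel \<Otimes>\<^sub>M borel)"
    unfolding normal_density_def by measurable
  show sets: "sets (gauss_model PX \<sigma> \<beta>) = sets (density (PX \<Otimes>\<^sub>M lborel) (\<lambda>z. ennreal (normal_density (\<beta> \<bullet> fst z) \<sigma> (snd z))))"
    unfolding gauss_model_def by (auto simp: sPX intro!: sets_pair_measure_cong)
  fix A assume "A \<in> sets (gauss_model PX \<sigma> \<beta>)"
  then have A [measurable]: "A \<in> sets (borel \<Otimes>\<^sub>M borel)" by (simp add: gauss_model_def)
  have "emeasure (gauss_model PX \<sigma> \<beta>) A = (\<integral>\<^sup>+z. indicator A z \<partial>gauss_model PX \<sigma> \<beta>)"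
    using A by (intro nn_integral_indicator[symmetric]) (simp add: gauss_model_def)
  also have "\<dots> = (\<integral>\<^sup>+w. indicator A (fst w, \<beta> \<bullet> fst w + snd w) \<partial>(PX \<Otimes>\<^sub>M gauss \<sigma>))"
    unfolding gauss_model_def by (subst nn_integral_distr) (auto simp: case_prod_beta')
  also have "\<dots> = (\<integral>\<^sup>+x. \<integral>\<^sup>+e. indicator A (x, \<beta> \<bullet> x + e) \<partial>gauss \<sigma> \<partial>PX)"
    by (subst N.nn_integral_fst[symmetric]) auto
  also have "\<dots> = (\<integral>\<^sup>+x. \<integral>\<^sup>+y. ennreal (normal_density (\<beta> \<bullet> x) \<sigma> y) * indicator A (x, y) \<partial>lborel \<partial>PX)"
  proof (rule nn_integral_cong)
    fix x
    have [measurable]: "(\<lambda>y. indicator A (x, y) :: ennreal) \<in> borel_measurable borel"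
      by measurable
    have "(\<integral>\<^sup>+e. indicator A (x, \<beta> \<bullet> x + e) \<partial>gauss \<sigma>)
        = (\<integral>\<^sup>+e. ennreal (normal_density (\<beta> \<bullet> x) \<sigma> (\<beta> \<bullet> x + e)) * indicator A (x, \<beta> \<bullet> x + e) \<partial>lborel)"
      by (subst nn_integral_density) (auto simp: normal_density_def)
    also have "\<dots> = (\<integral>\<^sup>+y. ennreal (normal_density (\<beta> \<bullet> x) \<sigma> y) * indicator A (x, y) \<partial>lborel)"
      by (rule nn_integral_lborel_shift) measurable
    finally show "(\<integral>\<^sup>+e. indicator A (x, \<beta> \<bullet> x + e) \<partial>gauss \<sigma>)
        = (\<integral>\<^sup>+y. ennreal (normal_density (\<beta> \<bullet> x) \<sigma> y) * indicator A (x, y) \<partial>lborel)" .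
  qed
  also have "\<dots> = (\<integral>\<^sup>+z. ennreal (normal_density (\<beta> \<bullet> fst z) \<sigma> (snd z)) * indicator A z \<partial>(PX \<Otimes>\<^sub>M lborel))"
    by (subst lborel.nn_integral_fst[symmetric]) auto
  also have "\<dots> = emeasure (density (PX \<Otimes>\<^sub>M lborel) (\<lambda>z. ennreal (normal_density (\<beta> \<bullet> fst z) \<sigma> (snd z)))) A"
    by (rule emeasure_density[symmetric]) measurable
  finally show "emeasure (gauss_model PX \<sigma> \<beta>) A
      = emeasure (density (PX \<Otimes>\<^sub>M lborel) (\<lambda>z. ennreal (normal_density (\<beta> \<bullet> fst z) \<sigma> (snd z)))) A" .
qed

definition gauss_prior :: "real \<Rightarrow> real ^ 'd \<Rightarrow> real" where
  "gauss_prior \<tau> \<beta> = (\<Prod>e\<in>Basis. normal_density 0 \<tau> (\<beta> \<bullet> e))"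

definition likelihood :: "nat \<Rightarrow> real \<Rightarrow> (nat \<Rightarrow> (real ^ 'd) \<times> real) \<Rightarrow> real ^ 'd \<Rightarrow> real" where
  "likelihood n \<sigma> S \<beta> = (\<Prod>i=1..n. normal_density (\<beta> \<bullet> fst (S i)) \<sigma> (snd (S i)))"

lemma nn_integral_gauss_prior:
  assumes "\<tau> > 0"
  shows "(\<integral>\<^sup>+\<beta>. ennreal (gauss_prior \<tau> \<beta> :: real) \<partial>(lborel :: (real ^ 'd) measure)) = 1"
proof -
  have 1: "(\<integral>\<^sup>+y. ennreal (normal_density 0 \<tau> y) \<partial>lborel) = 1"
    using assms by (simp add: nn_integral_eq_integral)
  have "(\<integral>\<^sup>+\<beta>. ennreal (gauss_prior \<tau> \<beta> :: real) \<partial>(lborel :: (real ^ 'd) measure))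
      = (\<integral>\<^sup>+\<beta>. (\<Prod>e\<in>Basis. ennreal (normal_density 0 \<tau> (\<beta> \<bullet> e))) \<partial>(lborel :: (real ^ 'd) measure))"
    unfolding gauss_prior_def by (simp add: prod_ennreal)
  also have "\<dots> = (\<Prod>e\<in>(Basis :: (real ^ 'd) set). \<integral>\<^sup>+y. ennreal (normal_density 0 \<tau> y) \<partial>lborel)"
    by (rule nn_integral_lborel_prod) auto
  finally show ?thesis by (simp add: 1)
qed

lemma measurable_gauss_prior [measurable]: "gauss_prior \<tau> \<in> borel_measurable borel"
  unfolding gauss_prior_def by measurable

lemma gauss_prior_pos: "\<tau> > 0 \<Longrightarrow> gauss_prior \<tau> \<beta> > 0"
  unfolding gauss_prior_def by (intro prod_pos) (auto simp: normal_density_pos)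

lemma likelihood_pos: "\<sigma> > 0 \<Longrightarrow> likelihood n \<sigma> S \<beta> > 0"
  unfolding likelihood_def by (intro prod_pos) (auto simp: normal_density_pos)

lemma measurable_likelihood:
  assumes "S \<in> M \<rightarrow>\<^sub>M PiM {1..n} (\<lambda>_. borel \<Otimes>\<^sub>M borel)" "b \<in> M \<rightarrow>\<^sub>M borel"
  shows "(\<lambda>w. likelihood n \<sigma> (S w) (b w)) \<in> borel_measurable M"
proof -
  note [measurable] = assms
  show ?thesis
    unfolding likelihood_def normal_density_def by measurable
qed

lemma measurable_likelihood_param [measurable]: "likelihood n \<sigma> S \<in> borel_measurable borel"
  unfolding likelihood_def normal_density_def by measurable

lemma posterior_integrable:
  fixes S :: "nat \<Rightarrow> (real ^ 'd) \<times> real"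
  assumes "\<sigma> > 0" "\<tau> > 0"
  shows "integrable lborel (\<lambda>\<beta>. gauss_prior \<tau> \<beta> * likelihood n \<sigma> S \<beta>)"
proof (rule Bochner_Integration.integrable_bound)
  let ?C = "1 / sqrt (2 * pi * \<sigma>\<^sup>2)"
  have "integrable lborel (gauss_prior \<tau> :: real ^ 'd \<Rightarrow> real)"
    using nn_integral_gauss_prior[OF assms(2), where 'd = 'd] gauss_prior_pos[OF assms(2)]
    by (intro integrableI_nonneg) (auto intro: less_imp_le)
  then show "integrable lborel (\<lambda>\<beta> :: real ^ 'd. gauss_prior \<tau> \<beta> * ?C ^ n)" by simp
  have "likelihood n \<sigma> S \<beta> \<le> (\<Prod>i=1..n. ?C)" for \<beta>
    unfolding likelihood_def
  proof (rule prod_mono, intro conjI)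
    fix i
    show "0 \<le> normal_density (\<beta> \<bullet> fst (S i)) \<sigma> (snd (S i))" by simp
    have "?C * exp (- (snd (S i) - \<beta> \<bullet> fst (S i))\<^sup>2 / (2 * \<sigma>\<^sup>2)) \<le> ?C * 1"
      by (intro mult_left_mono) auto
    then show "normal_density (\<beta> \<bullet> fst (S i)) \<sigma> (snd (S i)) \<le> ?C" by (simp add: normal_density_def)
  qed
  then show "AE \<beta> in lborel. norm (gauss_prior \<tau> \<beta> * likelihood n \<sigma> S \<beta>) \<le> norm (gauss_prior \<tau> \<beta> * ?C ^ n)"
    using gauss_prior_pos[OF assms(2), where 'a = 'd] likelihood_pos[OF assms(1), where 'a = 'd]
    by (intro always_eventually allI) (simp add: abs_mult abs_of_pos mult_left_mono)
qed measurable

text \<open>The curvatures of prior and likelihood add up; \<open>u \<bullet> (G / \<sigma>\<^sup>2 + I / \<tau>\<^sup>2) u\<close> is the posterior precision along \<open>u\<close>.\<close>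
lemma posterior_second_difference:
  fixes S :: "nat \<Rightarrow> (real ^ 'd) \<times> real"
  assumes "\<sigma> > 0" "\<tau> > 0"
  shows "(gauss_prior \<tau> (v - t *\<^sub>R u) * likelihood n \<sigma> S (v - t *\<^sub>R u))\<^sup>2
    = exp (t\<^sup>2 * ((norm u)\<^sup>2 / \<tau>\<^sup>2 + (\<Sum>i=1..n. (u \<bullet> fst (S i))\<^sup>2) / \<sigma>\<^sup>2)) * (gauss_prior \<tau> v * likelihood n \<sigma> S v)
      * (gauss_prior \<tau> (v - (2 * t) *\<^sub>R u) * likelihood n \<sigma> S (v - (2 * t) *\<^sub>R u))"
proof -
  have L: "(likelihood n \<sigma> S (v - t *\<^sub>R u))\<^sup>2
      = exp (t\<^sup>2 * (\<Sum>i=1..n. (u \<bullet> fst (S i))\<^sup>2 / \<sigma>\<^sup>2)) * likelihood n \<sigma> S v * likelihood n \<sigma> S (v - (2 * t) *\<^sub>R u)"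
    unfolding likelihood_def
    by (rule prod_second_difference) (use normal_density_second_difference[OF assms(1)] in auto)
  \<comment> \<open>The prior density is read as a likelihood in which each coordinate of \<open>v\<close> is observed to be 0.\<close>
  have swap: "normal_density 0 \<tau> y = normal_density y \<tau> 0" for y :: real
    by (simp add: normal_density_def power2_commute)
  have "(gauss_prior \<tau> (v - t *\<^sub>R u))\<^sup>2
      = exp (t\<^sup>2 * (\<Sum>e\<in>Basis. (u \<bullet> e)\<^sup>2 / \<tau>\<^sup>2)) * gauss_prior \<tau> v * gauss_prior \<tau> (v - (2 * t) *\<^sub>R u)"
    unfolding gauss_prior_def swap
    by (rule prod_second_difference) (use normal_density_second_difference[OF assms(2)] in auto)
  moreover have "(\<Sum>e\<in>Basis. (u \<bullet> e)\<^sup>2 / \<tau>\<^sup>2) = (norm u)\<^sup>2 / \<tau>\<^sup>2"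
  proof -
    have "(norm u)\<^sup>2 = (\<Sum>e\<in>Basis. (u \<bullet> e)\<^sup>2)"
      unfolding power2_norm_eq_inner by (subst euclidean_inner) (simp add: power2_eq_square)
    then show ?thesis by (simp add: sum_divide_distrib)
  qed
  ultimately have P: "(gauss_prior \<tau> (v - t *\<^sub>R u))\<^sup>2
      = exp (t\<^sup>2 * ((norm u)\<^sup>2 / \<tau>\<^sup>2)) * gauss_prior \<tau> v * gauss_prior \<tau> (v - (2 * t) *\<^sub>R u)" by simp
  show ?thesis
    unfolding power_mult_distrib L P by (simp add: distrib_left exp_add sum_divide_distrib[symmetric] mult_ac)
qed

text \<open>The value of \<open>2 (x \<bullet> u) - u \<bullet> (G / \<sigma>\<^sup>2 + I / \<tau>\<^sup>2) u\<close> at \<open>u = \<sigma>\<^sup>2 w\<close> with \<open>w = G\<inverse> x\<close>.  The maximum over \<open>u\<close> is the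
posterior variance of \<open>\<beta> \<bullet> x\<close>; this \<open>u\<close> is the maximizer for \<open>\<tau> = \<infinity>\<close> and falls short only by
a term that vanishes in that limit.\<close>
definition bayes_bound :: "nat \<Rightarrow> real \<Rightarrow> real \<Rightarrow> (nat \<Rightarrow> real ^ 'd) \<Rightarrow> real ^ 'd \<Rightarrow> real" where
  "bayes_bound n \<sigma> \<tau> X x = \<sigma>\<^sup>2 * (x \<bullet> cramer_solve (gram {1..n} X) x)
     - \<sigma>^4 / \<tau>\<^sup>2 * (norm (cramer_solve (gram {1..n} X) x))\<^sup>2"

text \<open>The unnormalized posterior density appears on both sides, so the estimate \<open>b\<close> and the sample \<open>S\<close> are
just fixed points here.\<close>
lemma posterior_risk_ge_bayes_bound:
  fixes S :: "nat \<Rightarrow> (real ^ 'd) \<times> real"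
  assumes "\<sigma> > 0" "\<tau> > 0"
  shows "(\<integral>\<^sup>+\<beta>. ennreal (bayes_bound n \<sigma> \<tau> (\<lambda>i. fst (S i)) x) * ennreal (gauss_prior \<tau> \<beta> * likelihood n \<sigma> S \<beta>) \<partial>lborel)
    \<le> (\<integral>\<^sup>+\<beta>. ennreal (((b - \<beta>) \<bullet> x)\<^sup>2 * (gauss_prior \<tau> \<beta> * likelihood n \<sigma> S \<beta>)) \<partial>lborel)"
proof -
  let ?w = "cramer_solve (gram {1..n} (\<lambda>i. fst (S i))) x"
  let ?H = "\<lambda>\<beta>. gauss_prior \<tau> \<beta> * likelihood n \<sigma> S \<beta>"
  let ?u = "\<sigma>\<^sup>2 *\<^sub>R ?w"
  let ?s = "(norm ?u)\<^sup>2 / \<tau>\<^sup>2 + (\<Sum>i=1..n. (?u \<bullet> fst (S i))\<^sup>2) / \<sigma>\<^sup>2"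
  have "(\<Sum>i=1..n. (?u \<bullet> fst (S i))\<^sup>2) = \<sigma>^4 * (x \<bullet> ?w)"
    by (simp add: sum_sq_cramer_solve_gram[symmetric] power_mult_distrib sum_distrib_left power_mult[symmetric])
  then have "2 * (x \<bullet> ?u) - ?s = bayes_bound n \<sigma> \<tau> (\<lambda>i. fst (S i)) x"
    using assms by (simp add: bayes_bound_def power_mult_distrib power_mult[symmetric] field_simps)
  moreover have "ennreal (2 * (x \<bullet> ?u) - ?s) * (\<integral>\<^sup>+\<beta>. ?H \<beta> \<partial>lborel)
      \<le> (\<integral>\<^sup>+\<beta>. ennreal (((b - \<beta>) \<bullet> x)\<^sup>2 * ?H \<beta>) \<partial>lborel)"
    by (rule chapman_robbins[OF _ posterior_integrable[OF assms] posterior_second_difference[OF assms]])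
       (intro mult_pos_pos gauss_prior_pos likelihood_pos assms)
  moreover have "(\<integral>\<^sup>+\<beta>. ennreal (bayes_bound n \<sigma> \<tau> (\<lambda>i. fst (S i)) x) * ennreal (?H \<beta>) \<partial>lborel)
      = ennreal (bayes_bound n \<sigma> \<tau> (\<lambda>i. fst (S i)) x) * (\<integral>\<^sup>+\<beta>. ?H \<beta> \<partial>lborel)"
    by (intro nn_integral_cmult) measurable
  ultimately show ?thesis by simp
qed

lemma nn_integral_gauss_model_sample:
  fixes PX :: "(real ^ 'd) measure" and \<Phi> :: "(nat \<Rightarrow> (real ^ 'd) \<times> real) \<Rightarrow> real ^ 'd \<Rightarrow> ennreal"
  assumes "prob_space PX" and sPX [measurable_cong]: "sets PX = sets borel" and "\<sigma> > 0"
    and \<Phi>: "(\<lambda>w. \<Phi> (fst w) (snd w)) \<in> borel_measurable (PiM {1..n} (\<lambda>_. PX \<Otimes>\<^sub>M lborel) \<Otimes>\<^sub>M PX)"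
  shows "(\<integral>\<^sup>+S. \<integral>\<^sup>+x. \<Phi> S x \<partial>PX \<partial>PiM {1..n} (\<lambda>_. gauss_model PX \<sigma> \<beta>))
    = (\<integral>\<^sup>+w. ennreal (likelihood n \<sigma> (fst w) \<beta>) * \<Phi> (fst w) (snd w) \<partial>(PiM {1..n} (\<lambda>_. PX \<Otimes>\<^sub>M lborel) \<Otimes>\<^sub>M PX))"
proof -
  interpret PX: prob_space PX by fact
  interpret Q: pair_sigma_finite PX "lborel :: real measure" ..
  interpret G: prob_space "gauss_model PX \<sigma> \<beta>"
    using joint_law_gauss_model[OF assms(1-3)] by (simp add: joint_law_def)
  note [measurable] = \<Phi>
  let ?f = "\<lambda>z. ennreal (normal_density (\<beta> \<bullet> fst z) \<sigma> (snd z))"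
  have f [measurable]: "?f \<in> borel_measurable (PX \<Otimes>\<^sub>M lborel)" unfolding normal_density_def by measurable
  have D: "PiM {1..n} (\<lambda>_. gauss_model PX \<sigma> \<beta>)
      = density (PiM {1..n} (\<lambda>_. PX \<Otimes>\<^sub>M lborel)) (\<lambda>S. ennreal (likelihood n \<sigma> S \<beta>))"
  proof -
    have "PiM {1..n} (\<lambda>_. gauss_model PX \<sigma> \<beta>)
        = density (PiM {1..n} (\<lambda>_. PX \<Otimes>\<^sub>M lborel)) (\<lambda>S. \<Prod>i=1..n. ?f (S i))"
      unfolding gauss_model_density[OF assms(1-3)]
      by (rule PiM_density_const[OF Q.sigma_finite_measure_axioms _ _ f])
         (use G.sigma_finite_measure_axioms in \<open>simp_all add: gauss_model_density[OF assms(1-3)]\<close>)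
    then show ?thesis by (simp add: likelihood_def prod_ennreal)
  qed
  have L: "(\<lambda>S. ennreal (likelihood n \<sigma> S \<beta>)) \<in> borel_measurable (PiM {1..n} (\<lambda>_. PX \<Otimes>\<^sub>M lborel))"
    by (intro measurable_compose[OF _ measurable_ennreal] measurable_likelihood) measurable
  have inner: "(\<lambda>S. \<integral>\<^sup>+x. \<Phi> S x \<partial>PX) \<in> borel_measurable (PiM {1..n} (\<lambda>_. PX \<Otimes>\<^sub>M lborel))"
    by (rule PX.borel_measurable_nn_integral) (use \<Phi> in \<open>simp add: case_prod_beta'\<close>)
  have \<Phi>S: "\<Phi> S \<in> borel_measurable PX" if "S \<in> space (PiM {1..n} (\<lambda>_. PX \<Otimes>\<^sub>M lborel))" for S
    using measurable_compose[OF measurable_Pair1'[OF that] \<Phi>] by simp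
  have "(\<integral>\<^sup>+S. \<integral>\<^sup>+x. \<Phi> S x \<partial>PX \<partial>PiM {1..n} (\<lambda>_. gauss_model PX \<sigma> \<beta>))
      = (\<integral>\<^sup>+S. ennreal (likelihood n \<sigma> S \<beta>) * (\<integral>\<^sup>+x. \<Phi> S x \<partial>PX) \<partial>PiM {1..n} (\<lambda>_. PX \<Otimes>\<^sub>M lborel))"
    unfolding D by (rule nn_integral_density[OF L inner])
  also have "\<dots> = (\<integral>\<^sup>+S. \<integral>\<^sup>+x. ennreal (likelihood n \<sigma> S \<beta>) * \<Phi> S x \<partial>PX \<partial>PiM {1..n} (\<lambda>_. PX \<Otimes>\<^sub>M lborel))"
    by (intro nn_integral_cong nn_integral_cmult[symmetric] \<Phi>S)
  also have "\<dots> = (\<integral>\<^sup>+w. ennreal (likelihood n \<sigma> (fst w) \<beta>) * \<Phi> (fst w) (snd w) \<partial>(PiM {1..n} (\<lambda>_. PX \<Otimes>\<^sub>M lborel) \<Otimes>\<^sub>M PX))"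
  proof (subst PX.nn_integral_fst[symmetric])
    show "(\<lambda>w. ennreal (likelihood n \<sigma> (fst w) \<beta>) * \<Phi> (fst w) (snd w))
        \<in> borel_measurable (PiM {1..n} (\<lambda>_. PX \<Otimes>\<^sub>M lborel) \<Otimes>\<^sub>M PX)"
      by (intro borel_measurable_times_ennreal \<Phi> measurable_compose[OF measurable_fst L])
  qed simp
  finally show ?thesis .
qed

lemma measurable_bayes_bound:
  assumes "\<And>i. i \<in> {1..n} \<Longrightarrow> f i \<in> borel_measurable M" "g \<in> borel_measurable M"
  shows "(\<lambda>w. ennreal (bayes_bound n \<sigma> \<tau> (\<lambda>i. f i w) (g w))) \<in> borel_measurable M"
proof -
  have [measurable]: "(\<lambda>w. cramer_solve (gram {1..n} (\<lambda>i. f i w)) (g w)) \<in> borel_measurable M"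
    using assms by (rule borel_measurable_cramer_solve_gram)
  note [measurable] = assms(2)
  show ?thesis unfolding bayes_bound_def by measurable
qed

text \<open>The supremum dominates the prior average of the risk.  After exchanging the integrals the bound holds
for each sample and test point separately; exchanging them back, the prior disappears, since
\<open>bayes_bound\<close> depends on the covariates only and their law is the same for every \<open>\<beta>\<close>.\<close>
lemma bayes_bound_le_sup_risk:
  fixes PX :: "(real ^ 'd) measure"
  assumes "prob_space PX" and sPX [measurable_cong]: "sets PX = sets borel" and "\<sigma> > 0" "\<tau> > 0"
    and sq: "integrable PX (\<lambda>x. (norm x)\<^sup>2)" and b: "b \<in> estimators n"
  shows "(\<integral>\<^sup>+X. \<integral>\<^sup>+x. ennreal (bayes_bound n \<sigma> \<tau> X x) \<partial>PX \<partial>PiM {1..n} (\<lambda>_. PX))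
    \<le> (SUP P\<in>P_Gauss PX \<sigma>. \<integral>\<^sup>+S. ennreal (excess_risk P (b S)) \<partial>PiM {1..n} (\<lambda>_. P))"
    (is "?B \<le> ?R")
proof -
  interpret PX: prob_space PX by fact
  interpret Q: pair_sigma_finite PX "lborel :: real measure" ..
  let ?M = "PiM {1..n} (\<lambda>_. PX \<Otimes>\<^sub>M (lborel :: real measure))" and ?G = "gauss_model PX \<sigma>"
  interpret M: product_sigma_finite "\<lambda>_. PX \<Otimes>\<^sub>M (lborel :: real measure)"
    by (simp add: product_sigma_finite_def Q.sigma_finite_measure_axioms)
  interpret M': sigma_finite_measure ?M by (rule M.sigma_finite) simp
  interpret N: pair_sigma_finite ?M PX ..
  interpret LN: pair_sigma_finite "?M \<Otimes>\<^sub>M PX" "lborel :: (real ^ 'd) measure" ..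
  let ?N = "?M \<Otimes>\<^sub>M PX"
  define \<pi> where "\<pi> \<beta> = ennreal (gauss_prior \<tau> \<beta>)" for \<beta> :: "real ^ 'd"
  define L where "L w \<beta> = ennreal (likelihood n \<sigma> (fst w) \<beta>)"
    for w :: "(nat \<Rightarrow> (real ^ 'd) \<times> real) \<times> (real ^ 'd)" and \<beta>
  define g where "g w = ennreal (bayes_bound n \<sigma> \<tau> (\<lambda>i. fst (fst w i)) (snd w))"
    for w :: "(nat \<Rightarrow> (real ^ 'd) \<times> real) \<times> (real ^ 'd)"
  define f where "f w \<beta> = ennreal (((b (fst w) - \<beta>) \<bullet> snd w)\<^sup>2)" for w and \<beta> :: "real ^ 'd"
  have \<pi>1: "(\<integral>\<^sup>+\<beta>. \<pi> \<beta> \<partial>lborel) = 1"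
    unfolding \<pi>_def by (rule nn_integral_gauss_prior) fact
  have \<pi> [measurable]: "\<pi> \<in> borel_measurable borel" unfolding \<pi>_def by measurable
  have b' [measurable]: "b \<in> ?M \<rightarrow>\<^sub>M borel"
  proof -
    have "sets ?M = sets (PiM {1..n} (\<lambda>_. borel :: ((real ^ 'd) \<times> real) measure))"
      by (rule sets_PiM_cong) (auto simp: borel_prod[symmetric] sPX intro!: sets_pair_measure_cong)
    then show ?thesis using b unfolding estimators_def by (simp cong: measurable_cong_sets)
  qed
  have L [measurable]: "(\<lambda>v. L (fst v) (snd v)) \<in> borel_measurable (?N \<Otimes>\<^sub>M lborel)"
    unfolding L_def by (intro measurable_compose[OF _ measurable_ennreal] measurable_likelihood) measurable
  have g [measurable]: "g \<in> borel_measurable ?N"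
    unfolding g_def by (rule measurable_bayes_bound) measurable
  have f [measurable]: "(\<lambda>v. f (fst v) (snd v)) \<in> borel_measurable (?N \<Otimes>\<^sub>M lborel)"
    unfolding f_def by measurable
  have L1 [measurable]: "(\<lambda>w. L w \<beta>) \<in> borel_measurable ?N" for \<beta>
    using measurable_compose[OF measurable_Pair2'[of \<beta> lborel ?N] L] by simp
  have f1 [measurable]: "(\<lambda>w. f w \<beta>) \<in> borel_measurable ?N" for \<beta>
    using measurable_compose[OF measurable_Pair2'[of \<beta> lborel ?N] f] by simp
  have risk: "(\<integral>\<^sup>+w. L w \<beta> * f w \<beta> \<partial>?N) \<le> ?R" for \<beta>
  proof -
    have "(\<integral>\<^sup>+w. L w \<beta> * f w \<beta> \<partial>?N) = (\<integral>\<^sup>+S. \<integral>\<^sup>+x. ennreal (((b S - \<beta>) \<bullet> x)\<^sup>2) \<partial>PX \<partial>PiM {1..n} (\<lambda>_. ?G \<beta>))"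
      using nn_integral_gauss_model_sample[OF assms(1-3), of "\<lambda>S x. ennreal (((b S - \<beta>) \<bullet> x)\<^sup>2)" n \<beta>] f1[of \<beta>]
      by (simp add: L_def f_def)
    also have "\<dots> = (\<integral>\<^sup>+S. ennreal (excess_risk (?G \<beta>) (b S)) \<partial>PiM {1..n} (\<lambda>_. ?G \<beta>))"
      by (simp add: excess_risk_gauss_model[OF assms(1-3) sq])
    also have "\<dots> \<le> ?R"
      by (rule SUP_upper) (rule gauss_model_in_P_Gauss[OF assms(1-3)])
    finally show ?thesis .
  qed
  have bound: "(\<integral>\<^sup>+w. L w \<beta> * g w \<partial>?N) = ?B" for \<beta>
  proof -
    have "(\<integral>\<^sup>+w. L w \<beta> * g w \<partial>?N)
        = (\<integral>\<^sup>+S. \<integral>\<^sup>+x. ennreal (bayes_bound n \<sigma> \<tau> (\<lambda>i. fst (S i)) x) \<partial>PX \<partial>PiM {1..n} (\<lambda>_. ?G \<beta>))"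
      using nn_integral_gauss_model_sample[OF assms(1-3),
          of "\<lambda>S x. ennreal (bayes_bound n \<sigma> \<tau> (\<lambda>i. fst (S i)) x)" n \<beta>] g
      by (simp add: L_def g_def[abs_def])
    also have "\<dots> = (\<integral>\<^sup>+S. \<integral>\<^sup>+x. ennreal (bayes_bound n \<sigma> \<tau> (compose {1..n} fst S) x) \<partial>PX \<partial>PiM {1..n} (\<lambda>_. ?G \<beta>))"
      unfolding bayes_bound_def gram_compose ..
    also have "\<dots> = ?B"
    proof (rule nn_integral_covariates[OF joint_law_gauss_model[OF assms(1-3)]])
      show "(\<lambda>X. \<integral>\<^sup>+x. ennreal (bayes_bound n \<sigma> \<tau> X x) \<partial>PX) \<in> borel_measurable (PiM {1..n} (\<lambda>_. borel))"
        by (rule PX.borel_measurable_nn_integral, unfold case_prod_beta', rule measurable_bayes_bound) measurable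
    qed simp
    finally show ?thesis .
  qed
  have "?B = (\<integral>\<^sup>+\<beta>. \<pi> \<beta> * ?B \<partial>lborel)"
    by (subst nn_integral_multc) (simp_all add: \<pi>1)
  also have "\<dots> = (\<integral>\<^sup>+\<beta>. \<integral>\<^sup>+w. \<pi> \<beta> * (L w \<beta> * g w) \<partial>?N \<partial>lborel)"
  proof -
    have "(\<integral>\<^sup>+w. \<pi> \<beta> * (L w \<beta> * g w) \<partial>?N) = \<pi> \<beta> * ?B" for \<beta>
      unfolding bound[of \<beta>, symmetric] by (rule nn_integral_cmult) measurable
    then show ?thesis by (simp only:)
  qed
  also have "\<dots> = (\<integral>\<^sup>+w. \<integral>\<^sup>+\<beta>. \<pi> \<beta> * (L w \<beta> * g w) \<partial>lborel \<partial>?N)"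
    by (rule LN.Fubini') (unfold case_prod_beta', measurable)
  also have "\<dots> \<le> (\<integral>\<^sup>+w. \<integral>\<^sup>+\<beta>. \<pi> \<beta> * (L w \<beta> * f w \<beta>) \<partial>lborel \<partial>?N)"
  proof (rule nn_integral_mono)
    fix w :: "(nat \<Rightarrow> (real ^ 'd) \<times> real) \<times> (real ^ 'd)"
    have "\<pi> \<beta> * (L w \<beta> * g w)
        = ennreal (bayes_bound n \<sigma> \<tau> (\<lambda>i. fst (fst w i)) (snd w)) * ennreal (gauss_prior \<tau> \<beta> * likelihood n \<sigma> (fst w) \<beta>)"
      and "\<pi> \<beta> * (L w \<beta> * f w \<beta>)
        = ennreal (((b (fst w) - \<beta>) \<bullet> snd w)\<^sup>2 * (gauss_prior \<tau> \<beta> * likelihood n \<sigma> (fst w) \<beta>))" for \<beta>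
      using gauss_prior_pos[OF assms(4), of \<beta>] likelihood_pos[OF assms(3), of n "fst w" \<beta>]
      by (simp_all add: \<pi>_def L_def g_def f_def ennreal_mult less_imp_le mult_ac)
    then show "(\<integral>\<^sup>+\<beta>. \<pi> \<beta> * (L w \<beta> * g w) \<partial>lborel) \<le> (\<integral>\<^sup>+\<beta>. \<pi> \<beta> * (L w \<beta> * f w \<beta>) \<partial>lborel)"
      using posterior_risk_ge_bayes_bound[OF assms(3,4), of n "fst w" "snd w" "b (fst w)"] by simp
  qed
  also have "\<dots> = (\<integral>\<^sup>+\<beta>. \<integral>\<^sup>+w. \<pi> \<beta> * (L w \<beta> * f w \<beta>) \<partial>?N \<partial>lborel)"
    by (rule LN.Fubini'[symmetric]) (unfold case_prod_beta', measurable)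
  also have "\<dots> = (\<integral>\<^sup>+\<beta>. \<pi> \<beta> * (\<integral>\<^sup>+w. L w \<beta> * f w \<beta> \<partial>?N) \<partial>lborel)"
    by (intro nn_integral_cong nn_integral_cmult) measurable
  also have "\<dots> \<le> (\<integral>\<^sup>+\<beta>. \<pi> \<beta> * ?R \<partial>lborel)"
    by (intro nn_integral_mono mult_left_mono risk) simp
  also have "\<dots> = ?R"
    by (subst nn_integral_multc) (simp_all add: \<pi>1)
  finally show ?thesis .
qed

section \<open>The minimax excess risk\<close>

text \<open>Flat-prior limit: as \<open>\<tau>\<close> runs through the positive integers, \<open>bayes_bound\<close> converges pointwise to
\<open>\<sigma>\<^sup>2 x \<bullet> w\<close> with \<open>w = G\<inverse> x\<close>, and Fatou's lemma carries the inequality over.\<close>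
lemma prediction_variance_le_sup_risk:
  fixes PX :: "(real ^ 'd) measure"
  assumes "prob_space PX" and sPX [measurable_cong]: "sets PX = sets borel" and "\<sigma> > 0"
    and sq: "integrable PX (\<lambda>x. (norm x)\<^sup>2)" and b: "b \<in> estimators n"
  shows "ennreal (\<sigma>\<^sup>2) * prediction_variance n PX
    \<le> (SUP P\<in>P_Gauss PX \<sigma>. \<integral>\<^sup>+S. ennreal (excess_risk P (b S)) \<partial>PiM {1..n} (\<lambda>_. P))"
    (is "_ \<le> ?R")
proof -
  interpret PX: prob_space PX by fact
  let ?XI = "PiM {1..n} (\<lambda>_. PX)"
  interpret XI: prob_space ?XI by (rule prob_space_PiM) (rule assms(1))
  interpret XX': pair_sigma_finite ?XI PX ..
  let ?N = "?XI \<Otimes>\<^sub>M PX"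
  define h where "h w = fst w \<bullet> cramer_solve (gram {1..n} (\<lambda>i. snd w i)) (fst w)"
    for w :: "(real ^ 'd) \<times> (nat \<Rightarrow> real ^ 'd)"
  have h [measurable]: "h \<in> borel_measurable (PX \<Otimes>\<^sub>M ?XI)"
    unfolding h_def by (intro borel_measurable_inner borel_measurable_cramer_solve_gram) measurable
  have gk: "(\<lambda>w. ennreal (bayes_bound n \<sigma> \<tau> (fst w) (snd w))) \<in> borel_measurable ?N" for \<tau>
    using measurable_bayes_bound[of n "\<lambda>i w. fst w i" ?N snd \<sigma> \<tau>] by simp
  have lim: "(\<lambda>k. ennreal (bayes_bound n \<sigma> (real (Suc k)) X x))
      \<longlonglongrightarrow> ennreal (\<sigma>\<^sup>2 * (x \<bullet> cramer_solve (gram {1..n} X) x))" for X x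
  proof (rule tendsto_ennrealI)
    have "(\<lambda>k. \<sigma>\<^sup>2 * (x \<bullet> cramer_solve (gram {1..n} X) x)
          - \<sigma>^4 * (inverse (real (Suc k)))\<^sup>2 * (norm (cramer_solve (gram {1..n} X) x))\<^sup>2)
        \<longlonglongrightarrow> \<sigma>\<^sup>2 * (x \<bullet> cramer_solve (gram {1..n} X) x)
          - \<sigma>^4 * 0\<^sup>2 * (norm (cramer_solve (gram {1..n} X) x))\<^sup>2"
      by (intro tendsto_intros LIMSEQ_inverse_real_of_nat)
    then show "(\<lambda>k. bayes_bound n \<sigma> (real (Suc k)) X x) \<longlonglongrightarrow> \<sigma>\<^sup>2 * (x \<bullet> cramer_solve (gram {1..n} X) x)"
      by (simp add: bayes_bound_def divide_inverse power_inverse)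
  qed
  have "ennreal (\<sigma>\<^sup>2) * prediction_variance n PX
      = (\<integral>\<^sup>+x. \<integral>\<^sup>+X. ennreal (\<sigma>\<^sup>2 * h (x, X)) \<partial>?XI \<partial>PX)"
    unfolding prediction_variance_def
  proof (subst nn_integral_cmult[symmetric])
    show "(\<lambda>x. \<integral>\<^sup>+X. ennreal (x \<bullet> cramer_solve (gram {1..n} X) x) \<partial>?XI) \<in> borel_measurable PX"
    proof (rule XI.borel_measurable_nn_integral)
      have "(\<lambda>w. ennreal (h w)) \<in> borel_measurable (PX \<Otimes>\<^sub>M ?XI)" by measurable
      then show "(\<lambda>(x, X). ennreal (x \<bullet> cramer_solve (gram {1..n} X) x)) \<in> borel_measurable (PX \<Otimes>\<^sub>M ?XI)"
        by (simp add: h_def case_prod_beta')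
    qed
    show "(\<integral>\<^sup>+x. ennreal (\<sigma>\<^sup>2) * (\<integral>\<^sup>+X. ennreal (x \<bullet> cramer_solve (gram {1..n} X) x) \<partial>?XI) \<partial>PX)
        = (\<integral>\<^sup>+x. \<integral>\<^sup>+X. ennreal (\<sigma>\<^sup>2 * h (x, X)) \<partial>?XI \<partial>PX)"
    proof (rule nn_integral_cong)
      fix x assume x: "x \<in> space PX"
      have "(\<lambda>X. ennreal (h (x, X))) \<in> borel_measurable ?XI"
        using measurable_compose[OF measurable_Pair1'[OF x] h] by measurable
      then show "ennreal (\<sigma>\<^sup>2) * (\<integral>\<^sup>+X. ennreal (x \<bullet> cramer_solve (gram {1..n} X) x) \<partial>?XI)
          = (\<integral>\<^sup>+X. ennreal (\<sigma>\<^sup>2 * h (x, X)) \<partial>?XI)"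
        by (simp add: h_def ennreal_mult' nn_integral_cmult)
    qed
  qed
  also have "\<dots> = (\<integral>\<^sup>+X. \<integral>\<^sup>+x. ennreal (\<sigma>\<^sup>2 * h (x, X)) \<partial>PX \<partial>?XI)"
    by (rule XX'.Fubini') (unfold case_prod_beta', measurable)
  also have "\<dots> = (\<integral>\<^sup>+w. ennreal (\<sigma>\<^sup>2 * h (snd w, fst w)) \<partial>?N)"
  proof -
    have "(\<lambda>w. ennreal (\<sigma>\<^sup>2 * h (snd w, fst w))) \<in> borel_measurable ?N" by measurable
    from PX.nn_integral_fst[OF this] show ?thesis by simp
  qed
  also have "\<dots> = (\<integral>\<^sup>+w. liminf (\<lambda>k. ennreal (bayes_bound n \<sigma> (real (Suc k)) (fst w) (snd w))) \<partial>?N)"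
    by (intro nn_integral_cong) (simp only: h_def fst_conv snd_conv lim_imp_Liminf[OF sequentially_bot lim])
  also have "\<dots> \<le> liminf (\<lambda>k. \<integral>\<^sup>+w. ennreal (bayes_bound n \<sigma> (real (Suc k)) (fst w) (snd w)) \<partial>?N)"
    by (rule nn_integral_liminf) (rule gk)
  also have "\<dots> \<le> ?R"
  proof (rule Liminf_le[OF sequentially_bot], rule always_eventually, rule allI)
    fix k
    show "(\<integral>\<^sup>+w. ennreal (bayes_bound n \<sigma> (real (Suc k)) (fst w) (snd w)) \<partial>?N) \<le> ?R"
      using bayes_bound_le_sup_risk[OF assms(1-3) _ sq b, of "real (Suc k)"]
      by (subst PX.nn_integral_fst[symmetric, OF gk]) simp
  qed
  finally show ?thesis .
qed

lemma nn_integral_leverage_odds: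
  fixes PX :: "(real ^ 'd) measure"
  assumes "prob_space PX" and sPX [measurable_cong]: "sets PX = sets borel"
    and nd: "\<not> degenerate PX" and n: "CARD('d) \<le> n"
  shows "(\<integral>\<^sup>+X. ennreal (leverage (n + 1) X / (1 - leverage (n + 1) X)) \<partial>PiM {1..n + 1} (\<lambda>_. PX))
    = prediction_variance n PX"
proof -
  interpret PX: prob_space PX by fact
  interpret product_prob_space "\<lambda>_. PX" "{1..n + 1}" ..
  have ins: "{1..n + 1} = insert (n + 1) {1..n}" by auto
  define h where "h X = ennreal (X (n + 1) \<bullet> cramer_solve (gram {1..n} X) (X (n + 1)))" for X :: "nat \<Rightarrow> real ^ 'd"
  have h: "h \<in> borel_measurable (PiM (insert (n + 1) {1..n}) (\<lambda>_. PX))"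
    unfolding h_def
    by (intro measurable_compose[OF _ measurable_ennreal] borel_measurable_inner borel_measurable_cramer_solve_gram)
       measurable
  have "(\<integral>\<^sup>+X. ennreal (leverage (n + 1) X / (1 - leverage (n + 1) X)) \<partial>PiM {1..n + 1} (\<lambda>_. PX))
      = (\<integral>\<^sup>+X. h X \<partial>PiM {1..n + 1} (\<lambda>_. PX))"
    by (rule nn_integral_cong_AE,
        use AE_det_gram_nonzero[OF assms(1) sPX nd, of "{1..n + 1}" "{1..n}"] n in \<open>auto elim!: eventually_mono simp: h_def leverage_odds[simplified]\<close>)
  also have "\<dots> = (\<integral>\<^sup>+x. \<integral>\<^sup>+X. h (X(n + 1 := x)) \<partial>PiM {1..n} (\<lambda>_. PX) \<partial>PX)"
    unfolding ins by (rule product_nn_integral_insert_rev[OF _ _ h]) auto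
  also have "\<dots> = prediction_variance n PX"
    unfolding prediction_variance_def h_def
    by (intro nn_integral_cong) (simp add: gram_update)
  finally show ?thesis .
qed

theorem theorem2:
  fixes PX :: "(real ^ 'd) measure" and n :: nat and \<sigma> :: real
  assumes "prob_space PX" and "sets PX = sets borel"
    and "\<sigma> > 0"
    and "integrable PX (\<lambda>x. (norm x)\<^sup>2)"
    and "invertible (second_moment PX)"
    and "\<not> degenerate PX"
    and "n \<ge> CARD('d)"
  shows "minimax_excess_risk n (P_well PX \<sigma>) =
           ennreal (\<sigma>\<^sup>2) * (\<integral>\<^sup>+ X. ennreal (leverage (n + 1) X / (1 - leverage (n + 1) X))
                              \<partial>(PiM {1..n + 1} (\<lambda>_. PX)))
       \<and> minimax_excess_risk n (P_Gauss PX \<sigma>) =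
           ennreal (\<sigma>\<^sup>2) * (\<integral>\<^sup>+ X. ennreal (leverage (n + 1) X / (1 - leverage (n + 1) X))
                              \<partial>(PiM {1..n + 1} (\<lambda>_. PX)))"
proof -
  let ?V = "ennreal (\<sigma>\<^sup>2) * prediction_variance n PX"
  have "minimax_excess_risk n (P_well PX \<sigma>) \<le> ?V"
    unfolding minimax_excess_risk_def
    by (rule INF_lower2[OF ols_in_estimators], rule SUP_least)
       (rule ols_risk_le_prediction_variance[OF _ assms(4,6,7)])
  moreover have "minimax_excess_risk n (P_Gauss PX \<sigma>) \<le> minimax_excess_risk n (P_well PX \<sigma>)"
    unfolding minimax_excess_risk_def
    by (intro INF_mono' SUP_subset_mono P_Gauss_subset_P_well assms(3) order_refl)
  moreover have "?V \<le> minimax_excess_risk n (P_Gauss PX \<sigma>)"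
    unfolding minimax_excess_risk_def
    by (rule INF_greatest) (rule prediction_variance_le_sup_risk[OF assms(1-4)])
  ultimately have "minimax_excess_risk n (P_well PX \<sigma>) = ?V \<and> minimax_excess_risk n (P_Gauss PX \<sigma>) = ?V"
    by auto
  then show ?thesis
    unfolding nn_integral_leverage_odds[OF assms(1,2,6,7)] .
qed

end
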